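(* Let $l>0$ and let $f_0\in H^3(\mathbb{T})$ be odd and satisfy the stability condition $\frac{1}{1+(\partial_x f_0(x))^2}>\frac{1}{1+l^2-(f_0(x))^2}$ for all $x$ (with $\|f_0\|_{L^\infty}<l$). Then there exists $\delta>0$ such that if $\|f_0\|_{H^3(\mathbb{T})}\leq\delta$, the solution of $$\partial_t f=\left(-\frac{1}{1+(\partial_x f)^2}+\frac{1}{1+l^2-f^2}\right)\Lambda f,\qquad f(\cdot,0)=f_0,$$ exists globally in time and satisfies $$\|f(t)\|_{C^1(\mathbb{T})}\leq\frac{l}{4}e^{-\mathcal{C}_l t}\quad\text{for all }t\ge0,\qquad \mathcal{C}_l=\frac{l^2}{1+l^2}.$$
   Context: $\Lambda=\sqrt{-\partial_x^2}$ is the operator with Fourier symbol $|\xi|$. *)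

theory Defs
  imports "HOL-Analysis.Analysis"
begin

text \<open>The torus T is identified with R / 2 pi Z; functions on T are 2 pi-periodic real functions.\<close>

definition periodic2pi :: "(real \<Rightarrow> real) \<Rightarrow> bool" where
  "periodic2pi f \<longleftrightarrow> (\<forall>x. f (x + 2 * pi) = f x)"

definition fourier_coeff :: "(real \<Rightarrow> real) \<Rightarrow> int \<Rightarrow> complex" where
  "fourier_coeff f k =
     integral {-pi..pi} (\<lambda>x. complex_of_real (f x) * cis (- (of_int k * x))) / complex_of_real (2 * pi)"

definition in_H3 :: "(real \<Rightarrow> real) \<Rightarrow> bool" where
  "in_H3 f \<longleftrightarrow> periodic2pi f \<and> continuous_on UNIV f \<and>
     (\<lambda>k::int. (1 + (real_of_int k)^2)^3 * (cmod (fourier_coeff f k))^2) summable_on UNIV"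

definition H3_norm :: "(real \<Rightarrow> real) \<Rightarrow> real" where
  "H3_norm f = sqrt (\<Sum>\<^sub>\<infinity>k::int. (1 + (real_of_int k)^2)^3 * (cmod (fourier_coeff f k))^2)"

text \<open>Lambda = sqrt(-d^2/dx^2), Fourier multiplier with symbol |k|.\<close>
definition Lambda :: "(real \<Rightarrow> real) \<Rightarrow> real \<Rightarrow> real" where
  "Lambda f x = Re (\<Sum>\<^sub>\<infinity>k::int. complex_of_int \<bar>k\<bar> * fourier_coeff f k * cis (of_int k * x))"

definition C1_norm :: "(real \<Rightarrow> real) \<Rightarrow> real" where
  "C1_norm g = (SUP x. \<bar>g x\<bar>) + (SUP x. \<bar>deriv g x\<bar>)"

end

theory Submission
  imports Defs
begin

text \<open>
  Write \<open>C = l^2 / (1 + l^2)\<close> and \<open>L = 1 + l^2\<close>. The equation is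
  \<open>f_t = - C \<Lambda>f + (Q + P) \<Lambda>f\<close> with \<open>Q = f_x^2 / (1 + f_x^2)\<close> and \<open>P = f^2 / (L (L - f^2))\<close>, so the nonlinearity is
  cubic. On the Fourier side one looks for coefficients of size
  \<open>exp (- C t (|k| + 1) / 2) / |k|^3\<close>. This weight is met at \<open>t = 0\<close> by small data in \<open>H^3\<close>; it decays like
  \<open>exp (- C t)\<close> for \<open>|k| \<ge> 1\<close>, and oddness removes the mode \<open>k = 0\<close>; and it makes \<open>f t\<close> analytic for
  \<open>t > 0\<close>. Since \<open>|k|\<close> is subadditive, sequences dominated by
  \<open>exp (- c |k|) / (1 + |k|)^2\<close> form an algebra under convolution, and a product of three factors gains
  an extra \<open>exp (- C t)\<close>. The Duhamel integral against \<open>exp (- C |k| (t - s))\<close> regains the power of \<open>|k|\<close> lost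
  to \<open>\<Lambda>f\<close>. Hence the Duhamel map is a contraction of a small ball in a weighted sup norm,
  and the Fourier series of its fixed point may be differentiated termwise.
\<close>

section \<open>Series indexed by the integers\<close>

text \<open>The powers of \<open>\<bar>k\<bar>\<close> balance exactly. Coefficients of order
  \<open>\<bar>k\<bar>^-3\<close> become \<open>\<bar>k\<bar>^-2\<close> under \<open>Lambda\<close>
  or d/dx; that rate is summable and stable under convolution, and the time integral returns the
  missing power. In time there is no room at all: the linear flow damps the modes
  \<open>\<bar>k\<bar> = 1\<close> at exactly the rate \<open>C\<close> that the weight demands. The
  forcing must therefore decay strictly faster than \<open>exp (- C t)\<close>, or its time integral
  would produce a factor \<open>t\<close>; the cubic structure provides this. Smallness enters
  through the product of the ball radius \<open>e\<close> and the convolution constant. The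
  threshold \<open>C / 128\<close> makes the Lipschitz constant of the Duhamel part 64/128 = 1/2,
  and the initial datum is allotted one half of the radius.\<close>

lemma summable_on_inverse_square_int:
  "(\<lambda>k::int. 1 / (1 + \<bar>real_of_int k\<bar>)^2) summable_on UNIV"
proof -
  let ?g = "\<lambda>k::int. 1 / (1 + \<bar>real_of_int k\<bar>)^2"
  have nat: "(\<lambda>n::nat. 1 / (1 + real n)^2) summable_on UNIV"
  proof (rule norm_summable_imp_summable_on)
    have "summable (\<lambda>n. inverse (real (Suc n) ^ 2))"
      by (subst summable_Suc_iff[of "\<lambda>n. inverse (real n ^ 2)"]) (simp add: inverse_power_summable)
    then show "summable (\<lambda>n. norm (1 / (1 + real n)^2))"
      by (simp add: inverse_eq_divide add.commute)
  qed
  have "?g summable_on range int"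
    using nat by (subst summable_on_reindex) (auto simp: o_def)
  moreover have "?g summable_on range (\<lambda>n. - int n)"
    using nat by (subst summable_on_reindex) (auto simp: o_def inj_def)
  moreover have "(UNIV :: int set) = range int \<union> range (\<lambda>n. - int n)"
    by (auto simp: image_iff) (metis int_cases2)
  ultimately show ?thesis
    using summable_on_union by metis
qed

lemma summable_on_int_reflect:
  fixes f :: "int \<Rightarrow> 'a::{comm_monoid_add,t2_space}"
  shows "(\<lambda>j. f (k - j)) summable_on UNIV \<longleftrightarrow> f summable_on UNIV"
proof -
  have "bij_betw (\<lambda>j::int. k - j) UNIV UNIV"
    by (rule bij_betwI[where g = "\<lambda>j. k - j"]) auto
  then show ?thesis by (rule summable_on_reindex_bij_betw)
qed

lemma infsum_int_reflect:
  fixes f :: "int \<Rightarrow> 'a::{comm_monoid_add,t2_space}"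
  shows "(\<Sum>\<^sub>\<infinity>j. f (k - j)) = (\<Sum>\<^sub>\<infinity>j. f j)"
proof -
  have "bij_betw (\<lambda>j::int. k - j) UNIV UNIV"
    by (rule bij_betwI[where g = "\<lambda>j. k - j"]) auto
  then show ?thesis by (rule infsum_reindex_bij_betw)
qed

lemma summable_on_dominated:
  fixes f :: "'a \<Rightarrow> 'b::banach"
  assumes "M summable_on X" "\<And>x. x \<in> X \<Longrightarrow> norm (f x) \<le> M x"
  shows "f summable_on X"
  by (rule abs_summable_summable) (rule Infinite_Sum.abs_summable_on_comparison_test'[OF assms])

lemma norm_infsum_dominated:
  fixes f :: "'a \<Rightarrow> 'b::banach"
  assumes "M summable_on X" "\<And>x. x \<in> X \<Longrightarrow> norm (f x) \<le> M x"
  shows "norm (\<Sum>\<^sub>\<infinity>x\<in>X. f x) \<le> (\<Sum>\<^sub>\<infinity>x\<in>X. M x)"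
  by (rule norm_infsum_le[OF has_sum_infsum has_sum_infsum])
     (use summable_on_dominated assms in auto)

lemma continuous_on_infsum_dominated:
  fixes f :: "'a \<Rightarrow> 'b::topological_space \<Rightarrow> 'c::banach"
  assumes "\<And>x. x \<in> X \<Longrightarrow> continuous_on Y (f x)" "M summable_on X"
    and "\<And>x y. x \<in> X \<Longrightarrow> y \<in> Y \<Longrightarrow> norm (f x y) \<le> M x"
  shows "continuous_on Y (\<lambda>y. \<Sum>\<^sub>\<infinity>x\<in>X. f x y)"
proof (rule uniform_limit_theorem)
  show "uniform_limit Y (\<lambda>X y. \<Sum>x\<in>X. f x y) (\<lambda>y. \<Sum>\<^sub>\<infinity>x\<in>X. f x y) (finite_subsets_at_top X)"
    by (rule Weierstrass_m_test_general) (use assms in auto)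
  show "\<forall>\<^sub>F n in finite_subsets_at_top X. continuous_on Y (\<lambda>y. \<Sum>x\<in>n. f x y)"
    by (rule eventually_finite_subsets_at_top_weakI)
       (use assms(1) in \<open>auto intro!: continuous_on_sum\<close>)
qed simp

text \<open>The enumeration \<open>int_decode\<close> transports the claim to termwise
  differentiation of an ordinary series. Working within a convex set covers both the whole line in
  \<open>x\<close> and the half-line in \<open>t\<close>, with a one-sided derivative at time
  0.\<close>

lemma has_field_derivative_infsum_int:
  fixes f :: "int \<Rightarrow> 'a::{real_normed_field,banach} \<Rightarrow> 'a"
  assumes "convex S" and deriv: "\<And>k x. x \<in> S \<Longrightarrow> (f k has_field_derivative f' k x) (at x within S)"
    and M: "M summable_on UNIV" and bound: "\<And>k x. x \<in> S \<Longrightarrow> norm (f' k x) \<le> M k"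
    and f: "\<And>x. x \<in> S \<Longrightarrow> (\<lambda>k. f k x) summable_on UNIV" and x: "x \<in> S"
  shows "((\<lambda>x. \<Sum>\<^sub>\<infinity>k. f k x) has_field_derivative (\<Sum>\<^sub>\<infinity>k. f' k x)) (at x within S)"
proof -
  have b: "bij_betw int_decode UNIV UNIV" by (rule bij_int_decode)
  have sums: "(\<lambda>n. g (int_decode n)) sums (\<Sum>\<^sub>\<infinity>k. g k)" if "g summable_on UNIV" for g :: "int \<Rightarrow> 'a"
    using that summable_on_reindex_bij_betw[OF b, of g] infsum_reindex_bij_betw[OF b, of g]
    by (metis has_sum_imp_sums has_sum_infsum)
  have "summable (\<lambda>n. M (int_decode n))"
    using M summable_on_reindex_bij_betw[OF b, of M] by (simp add: summable_on_imp_summable)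
  then have "uniform_limit S (\<lambda>n x. \<Sum>i<n. f' (int_decode i) x) (\<lambda>x. \<Sum>i. f' (int_decode i) x) sequentially"
    using bound by (intro Weierstrass_m_test) auto
  moreover have "summable (\<lambda>n. f (int_decode n) x)"
    using sums[OF f[OF x]] by (rule sums_summable)
  ultimately have "\<exists>g. \<forall>y\<in>S. (\<lambda>n. f (int_decode n) y) sums g y \<and>
      (g has_field_derivative (\<Sum>i. f' (int_decode i) y)) (at y within S)"
    using deriv x by (intro has_field_derivative_series[OF \<open>convex S\<close>]) auto
  then obtain g where
    g: "\<And>y. y \<in> S \<Longrightarrow> (\<lambda>n. f (int_decode n) y) sums g y"
       "\<And>y. y \<in> S \<Longrightarrow> (g has_field_derivative (\<Sum>i. f' (int_decode i) y)) (at y within S)"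
    by blast
  have "(\<lambda>k. f' k x) summable_on UNIV"
    using M bound[OF x] by (rule summable_on_dominated)
  then have "(\<Sum>i. f' (int_decode i) x) = (\<Sum>\<^sub>\<infinity>k. f' k x)"
    using sums_unique[OF sums] by simp
  moreover have "g y = (\<Sum>\<^sub>\<infinity>k. f k y)" if "y \<in> S" for y
    using sums[OF f[OF that]] g(1)[OF that] sums_unique2 by blast
  ultimately show ?thesis
    using has_field_derivative_transform_within[OF g(2)[OF x] zero_less_one x] by simp
qed

section \<open>Convolution\<close>

definition conv :: "(int \<Rightarrow> real) \<Rightarrow> (int \<Rightarrow> real) \<Rightarrow> int \<Rightarrow> real" where
  "conv a b k = (\<Sum>\<^sub>\<infinity>j. a j * b (k - j))"

definition ws :: "real \<Rightarrow> int \<Rightarrow> real" where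
  "ws c k = exp (- (c * \<bar>of_int k\<bar>)) / (1 + \<bar>of_int k\<bar>)^2"

text \<open>The algebra constant of convolution: one factor 2 comes from
  \<open>(x + y)^2 \<le> 2 * (x^2 + y^2)\<close>, the other from the two summands
  \<open>ws 0 j\<close> and \<open>ws 0 (k - j)\<close>, which have the same total.\<close>

definition wconst :: real where
  "wconst = 4 * (\<Sum>\<^sub>\<infinity>k. ws 0 k)"

lemma ws_pos [simp]: "0 < ws c k"
  by (simp add: ws_def add_pos_nonneg)

lemma ws_nonneg [simp]: "0 \<le> ws c k"
  by (simp add: less_imp_le)

lemma ws_minus [simp]: "ws c (- k) = ws c k"
  by (simp add: ws_def)

lemma ws_le_ws0: "0 \<le> c \<Longrightarrow> ws c k \<le> ws 0 k"
  by (simp add: ws_def divide_right_mono)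

lemma summable_ws0: "ws 0 summable_on UNIV"
  using summable_on_inverse_square_int by (simp add: ws_def[abs_def])

lemma infsum_ws0_ge_1: "1 \<le> (\<Sum>\<^sub>\<infinity>k. ws 0 k)"
  using finite_sum_le_infsum[OF summable_ws0, of "{0}"] by (simp add: ws_def[of 0 0])

lemma wconst_ge_1: "1 \<le> wconst"
  using infsum_ws0_ge_1 by (simp add: wconst_def)

text \<open>The exponentials are handled by the triangle inequality. For the polynomial part,
  \<open>z^2 \<le> 2 * (x^2 + y^2)\<close> is divided by \<open>x^2 * y^2 * z^2\<close>. The weight
  at \<open>k\<close> splits off, leaving a factor summable in \<open>j\<close>.\<close>

lemma ws_mult_le:
  assumes "0 \<le> c"
  shows "ws c j * ws c (k - j) \<le> 2 * ws c k * (ws 0 j + ws 0 (k - j))"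
proof -
  define x y z where "x = 1 + \<bar>real_of_int j\<bar>" and "y = 1 + \<bar>real_of_int (k - j)\<bar>"
    and "z = 1 + \<bar>real_of_int k\<bar>"
  have pos: "x > 0" "y > 0" "z > 0" and zle: "z \<le> x + y"
    by (auto simp: x_def y_def z_def)
  have "z^2 \<le> (x + y)^2"
    using pos zle by (intro power_mono) auto
  also have "\<dots> \<le> 2 * (x^2 + y^2)"
    using sum_squares_bound[of x y] by (simp add: power2_sum)
  finally have z2: "z^2 \<le> 2 * (x^2 + y^2)" .
  have "c * \<bar>of_int k\<bar> \<le> c * (\<bar>of_int j\<bar> + \<bar>of_int (k - j)\<bar>)"
    using assms by (intro mult_left_mono) auto
  then have e: "exp (- (c * \<bar>of_int j\<bar>)) * exp (- (c * \<bar>of_int (k - j)\<bar>)) \<le> exp (- (c * \<bar>real_of_int k\<bar>))"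
    by (simp add: exp_add[symmetric] algebra_simps)
  have "1 / (x^2 * y^2) \<le> 2 * (1 / z^2) * (1 / x^2 + 1 / y^2)"
    using pos z2 by (simp add: field_simps)
  then have "exp (- (c * \<bar>of_int j\<bar>)) * exp (- (c * \<bar>of_int (k - j)\<bar>)) * (1 / (x^2 * y^2))
      \<le> exp (- (c * \<bar>real_of_int k\<bar>)) * (2 * (1 / z^2) * (1 / x^2 + 1 / y^2))"
    using e by (intro mult_mono) auto
  then show ?thesis
    by (simp add: ws_def x_def y_def z_def algebra_simps)
qed

lemma conv_dominated:
  assumes "0 \<le> c" "0 \<le> A" "0 \<le> B" "\<And>j. \<bar>a j\<bar> \<le> A * ws c j" "\<And>j. \<bar>b j\<bar> \<le> B * ws c j"
  shows "norm (a j * b (k - j)) \<le> 2 * A * B * ws c k * (ws 0 j + ws 0 (k - j))"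
proof -
  have "norm (a j * b (k - j)) \<le> (A * ws c j) * (B * ws c (k - j))"
    unfolding real_norm_def abs_mult using assms by (intro mult_mono) auto
  also have "\<dots> = A * B * (ws c j * ws c (k - j))" by simp
  also have "\<dots> \<le> A * B * (2 * ws c k * (ws 0 j + ws 0 (k - j)))"
    using assms ws_mult_le by (intro mult_left_mono) auto
  finally show ?thesis by (simp add: mult_ac)
qed

lemma summable_conv_majorant: "(\<lambda>j. D * (ws 0 j + ws 0 (k - j))) summable_on UNIV"
  by (intro summable_on_cmult_right summable_on_add summable_ws0)
     (simp add: summable_on_int_reflect summable_ws0)

lemma infsum_conv_majorant: "(\<Sum>\<^sub>\<infinity>j. 2 * A * B * ws c k * (ws 0 j + ws 0 (k - j))) = wconst * A * B * ws c k"
proof -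
  have "(\<Sum>\<^sub>\<infinity>j. ws 0 j + ws 0 (k - j)) = 2 * (\<Sum>\<^sub>\<infinity>j. ws 0 j)"
    using infsum_add[OF summable_ws0, of "\<lambda>j. ws 0 (k - j)"]
    by (simp add: summable_on_int_reflect summable_ws0 infsum_int_reflect)
  then show ?thesis
    by (subst infsum_cmult_right') (simp add: wconst_def)
qed

lemma conv_summable:
  assumes "0 \<le> c" "0 \<le> A" "0 \<le> B" "\<And>j. \<bar>a j\<bar> \<le> A * ws c j" "\<And>j. \<bar>b j\<bar> \<le> B * ws c j"
  shows "(\<lambda>j. a j * b (k - j)) summable_on UNIV"
  by (rule summable_on_dominated[OF summable_conv_majorant conv_dominated[OF assms]])

lemma conv_bound:
  assumes "0 \<le> c" "0 \<le> A" "0 \<le> B" "\<And>j. \<bar>a j\<bar> \<le> A * ws c j" "\<And>j. \<bar>b j\<bar> \<le> B * ws c j"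
  shows "\<bar>conv a b k\<bar> \<le> wconst * A * B * ws c k"
  using norm_infsum_dominated[OF summable_conv_majorant conv_dominated[OF assms]]
  by (simp add: conv_def infsum_conv_majorant)

text \<open>Bilinearity: \<open>a b - a' b' = (a - a') b + a' (b - b')\<close>, and each piece is an
  instance of \<open>conv_bound\<close>.\<close>

lemma conv_diff_bound:
  assumes c: "0 \<le> c" "0 \<le> A" "0 \<le> B" "0 \<le> D" "0 \<le> E"
    and a: "\<And>j. \<bar>a j\<bar> \<le> A * ws c j" "\<And>j. \<bar>a' j\<bar> \<le> A * ws c j" "\<And>j. \<bar>a j - a' j\<bar> \<le> D * ws c j"
    and b: "\<And>j. \<bar>b j\<bar> \<le> B * ws c j" "\<And>j. \<bar>b' j\<bar> \<le> B * ws c j" "\<And>j. \<bar>b j - b' j\<bar> \<le> E * ws c j"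
  shows "\<bar>conv a b k - conv a' b' k\<bar> \<le> wconst * (D * B + A * E) * ws c k"
proof -
  have s1: "(\<lambda>j. (a j - a' j) * b (k - j)) summable_on UNIV"
    by (rule conv_summable[OF c(1,4,3) a(3) b(1)])
  have s2: "(\<lambda>j. a' j * (b (k - j) - b' (k - j))) summable_on UNIV"
    using conv_summable[OF c(1,2,5) a(2), of "\<lambda>j. b j - b' j"] b(3) by simp
  have "conv a b k - conv a' b' k = (\<Sum>\<^sub>\<infinity>j. a j * b (k - j) + - (a' j * b' (k - j)))"
    unfolding conv_def
    using infsum_add[OF conv_summable[OF c(1-3) a(1) b(1)]
        summable_on_uminus[THEN iffD2, OF conv_summable[OF c(1-3) a(2) b(2)]]]
    by (simp add: infsum_uminus)
  also have "\<dots> = (\<Sum>\<^sub>\<infinity>j. (a j - a' j) * b (k - j) + a' j * (b (k - j) - b' (k - j)))"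
    by (intro infsum_cong) (simp add: algebra_simps)
  also have "\<dots> = conv (\<lambda>j. a j - a' j) b k + conv a' (\<lambda>j. b j - b' j) k"
    unfolding conv_def by (rule infsum_add[OF s1 s2])
  finally have "\<bar>conv a b k - conv a' b' k\<bar> \<le> \<bar>conv (\<lambda>j. a j - a' j) b k\<bar> + \<bar>conv a' (\<lambda>j. b j - b' j) k\<bar>"
    by linarith
  also have "\<dots> \<le> wconst * D * B * ws c k + wconst * A * E * ws c k"
    by (intro add_mono conv_bound c a b)
  finally show ?thesis by (simp add: algebra_simps)
qed

lemma conv_parity:
  assumes "\<And>k. a (- k) = p * a k" "\<And>k. b (- k) = q * b k"
  shows "conv a b (- k) = p * q * conv a b k"
proof -
  have "conv a b (- k) = (\<Sum>\<^sub>\<infinity>j. a (0 - j) * b (- k - (0 - j)))"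
    unfolding conv_def by (rule infsum_int_reflect[symmetric])
  also have "\<dots> = (\<Sum>\<^sub>\<infinity>j. (p * q) * (a j * b (k - j)))"
  proof (rule infsum_cong)
    fix j
    have "b (- k - (0 - j)) = q * b (k - j)"
      using assms(2)[of "k - j"] by simp
    then show "a (0 - j) * b (- k - (0 - j)) = (p * q) * (a j * b (k - j))"
      using assms(1)[of j] by simp
  qed
  finally show ?thesis
    by (simp add: conv_def infsum_cmult_right')
qed

lemma continuous_on_conv:
  assumes a: "\<And>k. continuous_on T (\<lambda>t. a t k)" "\<And>t k. t \<in> T \<Longrightarrow> \<bar>a t k\<bar> \<le> A * ws 0 k"
    and b: "\<And>k. continuous_on T (\<lambda>t. b t k)" "\<And>t k. t \<in> T \<Longrightarrow> \<bar>b t k\<bar> \<le> B * ws 0 k"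
    and "0 \<le> A" "0 \<le> B"
  shows "continuous_on T (\<lambda>t. conv (a t) (b t) k)"
  unfolding conv_def
  by (rule continuous_on_infsum_dominated[OF _ summable_conv_majorant])
     (use assms in \<open>auto intro!: continuous_on_mult conv_dominated simp del: real_norm_def\<close>)

section \<open>Fourier series\<close>

text \<open>Real coefficients suffice because parity is tracked: an odd sequence sums to
  \<open>\<i>\<close> times a sine series, an even one to a cosine series.\<close>

definition fser :: "(int \<Rightarrow> real) \<Rightarrow> real \<Rightarrow> complex" where
  "fser a x = (\<Sum>\<^sub>\<infinity>k. of_real (a k) * cis (of_int k * x))"

definition wbounded :: "(int \<Rightarrow> real) \<Rightarrow> bool" where
  "wbounded a \<longleftrightarrow> (\<exists>A\<ge>0. \<forall>k. \<bar>a k\<bar> \<le> A * ws 0 k)"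

lemma wboundedI: "0 \<le> A \<Longrightarrow> 0 \<le> c \<Longrightarrow> (\<And>k. \<bar>a k\<bar> \<le> A * ws c k) \<Longrightarrow> wbounded a"
  unfolding wbounded_def by (meson mult_left_mono order_trans ws_le_ws0)

lemma wbounded_add:
  assumes "wbounded a" "wbounded b"
  shows "wbounded (\<lambda>k. a k + b k)"
proof -
  obtain A B where "0 \<le> A" "0 \<le> B" and ab: "\<And>k. \<bar>a k\<bar> \<le> A * ws 0 k" "\<And>k. \<bar>b k\<bar> \<le> B * ws 0 k"
    using assms by (auto simp: wbounded_def)
  have "\<bar>a k + b k\<bar> \<le> (A + B) * ws 0 k" for k
    using ab[of k] by (simp add: algebra_simps abs_le_iff)
  with \<open>0 \<le> A\<close> \<open>0 \<le> B\<close> show ?thesis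
    by (intro wboundedI[of "A + B" 0]) auto
qed

lemma wbounded_cmult:
  assumes "wbounded a"
  shows "wbounded (\<lambda>k. r * a k)"
proof -
  obtain A where "0 \<le> A" and a: "\<And>k. \<bar>a k\<bar> \<le> A * ws 0 k"
    using assms by (auto simp: wbounded_def)
  have "\<bar>r * a k\<bar> \<le> (\<bar>r\<bar> * A) * ws 0 k" for k
    using a[of k] by (simp add: abs_mult mult.assoc mult_left_mono)
  with \<open>0 \<le> A\<close> show ?thesis
    by (intro wboundedI[of "\<bar>r\<bar> * A" 0]) auto
qed

lemma wbounded_conv:
  assumes "wbounded a" "wbounded b"
  shows "wbounded (conv a b)"
proof -
  obtain A B where AB: "0 \<le> A" "0 \<le> B" and ab: "\<And>k. \<bar>a k\<bar> \<le> A * ws 0 k" "\<And>k. \<bar>b k\<bar> \<le> B * ws 0 k"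
    using assms by (auto simp: wbounded_def)
  show ?thesis
    by (rule wboundedI[OF _ order.refl conv_bound[OF order.refl AB ab]])
       (use AB wconst_ge_1 in auto)
qed

lemma summable_fser:
  assumes "wbounded a"
  shows "(\<lambda>k. of_real (a k) * cis (of_int k * x)) summable_on UNIV"
proof -
  obtain A where a: "\<And>k. \<bar>a k\<bar> \<le> A * ws 0 k"
    using assms by (auto simp: wbounded_def)
  have "(\<lambda>k. A * ws 0 k) summable_on UNIV"
    by (intro summable_on_cmult_right summable_ws0)
  then show ?thesis
    by (rule summable_on_dominated) (simp add: norm_mult a)
qed

lemma norm_fser_le:
  assumes "\<And>k. \<bar>a k\<bar> \<le> A * ws 0 k"
  shows "norm (fser a x) \<le> A * (\<Sum>\<^sub>\<infinity>k. ws 0 k)"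
proof -
  have "(\<lambda>k. A * ws 0 k) summable_on UNIV"
    by (intro summable_on_cmult_right summable_ws0)
  then have "norm (fser a x) \<le> (\<Sum>\<^sub>\<infinity>k. A * ws 0 k)"
    unfolding fser_def by (rule norm_infsum_dominated) (simp add: norm_mult assms)
  then show ?thesis
    by (simp add: infsum_cmult_right')
qed

lemma fser_add:
  "wbounded a \<Longrightarrow> wbounded b \<Longrightarrow> fser (\<lambda>k. a k + b k) x = fser a x + fser b x"
  unfolding fser_def by (subst infsum_add[symmetric]) (auto simp: summable_fser distrib_right)

lemma fser_cmult: "fser (\<lambda>k. r * a k) x = of_real r * fser a x"
  unfolding fser_def by (subst infsum_cmult_right'[symmetric]) (simp add: mult.assoc)

lemma Re_fser: "wbounded a \<Longrightarrow> Re (fser a x) = (\<Sum>\<^sub>\<infinity>k. a k * cos (of_int k * x))"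
  unfolding fser_def by (subst infsum_Re[symmetric]) (auto simp: summable_fser)

lemma Im_fser: "wbounded a \<Longrightarrow> Im (fser a x) = (\<Sum>\<^sub>\<infinity>k. a k * sin (of_int k * x))"
  unfolding fser_def by (subst infsum_Im[symmetric]) (auto simp: summable_fser)

text \<open>Interchange of a double sum. The majorant is summable over pairs since its inner sum
  over \<open>k\<close> is translation invariant, hence equal to a constant times
  \<open>ws 0 j\<close>.\<close>

lemma fser_conv:
  assumes "wbounded a" "wbounded b"
  shows "fser (conv a b) x = fser a x * fser b x"
proof -
  obtain A B where AB: "0 \<le> A" "0 \<le> B" and ab: "\<And>k. \<bar>a k\<bar> \<le> A * ws 0 k" "\<And>k. \<bar>b k\<bar> \<le> B * ws 0 k"
    using assms by (auto simp: wbounded_def)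
  define F where "F j k = of_real (a j * b (k - j)) * cis (of_int k * x)" for j k :: int
  have shift: "(\<lambda>k. ws 0 (k - j)) = (\<lambda>k. ws 0 (j - k))" for j
    by (metis minus_diff_eq ws_minus)
  have "(\<lambda>(j,k). A * ws 0 j * (B * ws 0 (k - j))) summable_on (UNIV \<times> UNIV)"
  proof (rule summable_on_SigmaI)
    fix j :: int
    have "((\<lambda>k. ws 0 (k - j)) has_sum (\<Sum>\<^sub>\<infinity>k. ws 0 k)) UNIV"
      unfolding shift using has_sum_infsum[OF summable_on_int_reflect[THEN iffD2, OF summable_ws0], of j]
      by (simp add: infsum_int_reflect)
    from has_sum_cmult_right[OF this, of "A * ws 0 j * B"]
    show "((\<lambda>k. case (j, k) of (j, k) \<Rightarrow> A * ws 0 j * (B * ws 0 (k - j))) has_sum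
       A * ws 0 j * B * (\<Sum>\<^sub>\<infinity>k. ws 0 k)) UNIV"
      by (simp add: mult_ac)
  next
    show "(\<lambda>j. A * ws 0 j * B * (\<Sum>\<^sub>\<infinity>k. ws 0 k)) summable_on UNIV"
      by (intro summable_on_cmult_left summable_on_cmult_right summable_ws0)
  qed (use AB in auto)
  then have "(\<lambda>(j,k). F j k) summable_on (UNIV \<times> UNIV)"
  proof (rule summable_on_dominated)
    show "norm (case z of (j, k) \<Rightarrow> F j k) \<le> (case z of (j, k) \<Rightarrow> A * ws 0 j * (B * ws 0 (k - j)))" for z
      using AB ab by (cases z) (auto simp: F_def norm_mult abs_mult intro!: mult_mono)
  qed
  then have swap: "(\<Sum>\<^sub>\<infinity>j. \<Sum>\<^sub>\<infinity>k. F j k) = (\<Sum>\<^sub>\<infinity>k. \<Sum>\<^sub>\<infinity>j. F j k)"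
    by (rule infsum_swap_banach)
  have "fser (conv a b) x = (\<Sum>\<^sub>\<infinity>k. \<Sum>\<^sub>\<infinity>j. F j k)"
    unfolding fser_def
  proof (rule infsum_cong)
    fix k :: int
    have "((\<lambda>j. complex_of_real (a j * b (k - j))) has_sum of_real (conv a b k)) UNIV"
      unfolding conv_def
      by (intro has_sum_of_real has_sum_infsum conv_summable[OF order.refl AB ab])
    from has_sum_cmult_left[OF this, of "cis (of_int k * x)"]
    show "of_real (conv a b k) * cis (of_int k * x) = (\<Sum>\<^sub>\<infinity>j. F j k)"
      by (simp add: F_def infsumI)
  qed
  also have "\<dots> = (\<Sum>\<^sub>\<infinity>j. of_real (a j) * cis (of_int j * x) * fser b x)"
    unfolding swap[symmetric]
  proof (rule infsum_cong)
    fix j :: int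
    \<comment> \<open>The available substitution is the reflection of \<open>k\<close> into
      \<open>j - k\<close>, so the translation by \<open>j\<close> is written as two reflections of
      a reversed sequence.\<close>
    define h where "h k = complex_of_real (b (- k)) * cis (of_int (- k) * x)" for k :: int
    have "F j k = of_real (a j) * cis (of_int j * x) * h (j - k)" for k
      by (simp add: F_def h_def cis_mult algebra_simps)
    then have "(\<Sum>\<^sub>\<infinity>k. F j k) = of_real (a j) * cis (of_int j * x) * (\<Sum>\<^sub>\<infinity>k. h (j - k))"
      by (simp add: infsum_cmult_right')
    also have "(\<Sum>\<^sub>\<infinity>k. h (j - k)) = (\<Sum>\<^sub>\<infinity>k. h (0 - k))"
      by (simp only: infsum_int_reflect)
    also have "\<dots> = fser b x"
      by (simp add: h_def fser_def)
    finally show "(\<Sum>\<^sub>\<infinity>k. F j k) = of_real (a j) * cis (of_int j * x) * fser b x" .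
  qed
  also have "\<dots> = fser a x * fser b x"
    by (simp add: infsum_cmult_left' fser_def)
  finally show ?thesis .
qed

lemma infsum_int_odd:
  fixes g :: "int \<Rightarrow> real"
  assumes "\<And>k. g (- k) = - g k"
  shows "(\<Sum>\<^sub>\<infinity>k. g k) = 0"
  using infsum_int_reflect[of g 0] by (simp add: assms infsum_uminus)

lemma fser_odd:
  assumes "wbounded a" "\<And>k. a (- k) = - a k"
  shows "fser a x = \<i> * of_real (Im (fser a x))"
  using assms infsum_int_odd[of "\<lambda>k. a k * cos (of_int k * x)"] by (simp add: complex_eq_iff Re_fser)

lemma fser_even:
  assumes "wbounded a" "\<And>k. a (- k) = a k"
  shows "fser a x = of_real (Re (fser a x))"
  using assms infsum_int_odd[of "\<lambda>k. a k * sin (of_int k * x)"] by (simp add: complex_eq_iff Im_fser)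

lemma Im_fser_deriv:
  assumes a: "wbounded a" and ka: "wbounded (\<lambda>k. of_int k * a k)"
  shows "((\<lambda>x. Im (fser a x)) has_real_derivative Re (fser (\<lambda>k. of_int k * a k) x)) (at x)"
proof -
  obtain A where A: "\<And>k. \<bar>of_int k * a k\<bar> \<le> A * ws 0 k"
    using ka by (auto simp: wbounded_def)
  have "((\<lambda>x. \<Sum>\<^sub>\<infinity>k. a k * sin (of_int k * x)) has_field_derivative
      (\<Sum>\<^sub>\<infinity>k. of_int k * a k * cos (of_int k * x))) (at x within UNIV)"
  proof (rule has_field_derivative_infsum_int)
    show "(\<lambda>k. A * ws 0 k) summable_on UNIV"
      by (intro summable_on_cmult_right summable_ws0)
    show "((\<lambda>x. a k * sin (of_int k * x)) has_field_derivative of_int k * a k * cos (of_int k * x)) (at x)" for k x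
      by (auto intro!: derivative_eq_intros)
    show "norm (of_int k * a k * cos (of_int k * x)) \<le> A * ws 0 k" for k x
      using mult_mono[OF A[of k] abs_cos_le_one[of "of_int k * x"]] order_trans[OF abs_ge_zero A[of k]]
      by (simp add: abs_mult)
    show "(\<lambda>k. a k * sin (of_int k * x)) summable_on UNIV" for x
      using summable_on_Im[OF summable_fser[OF a, of x]] by simp
  qed auto
  then show ?thesis
    by (simp add: Im_fser[OF a] Re_fser[OF ka])
qed

lemma fser_periodic: "fser a (x + 2 * pi) = fser a x"
proof -
  have "cis (of_int k * (x + 2 * pi)) = cis (of_int k * x)" for k
    using cis_mult[of "of_int k * x" "2 * pi * of_int k"] cis_multiple_2pi[of "of_int k"]
    by (simp add: algebra_simps)
  then show ?thesis
    by (simp add: fser_def)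
qed

section \<open>Orthogonality and recovery of the coefficients\<close>

lemma integral_cis_int:
  "((\<lambda>x. cis (of_int n * x)) has_integral (if n = 0 then 2 * pi else 0)) {-pi..pi}"
proof (cases "n = 0")
  case True
  then show ?thesis
    using has_integral_const_real[of "1::complex" "-pi" pi] by (simp add: scaleR_conv_of_real)
next
  case False
  have "((\<lambda>x. cis (of_int n * x) / (\<i> * of_int n)) has_vector_derivative cis (of_int n * x)) (at x within {-pi..pi})" for x
    using False
    by (auto intro!: derivative_eq_intros has_vector_derivative_real_field simp: cis_conv_exp scaleR_conv_of_real mult_ac)
  then have "((\<lambda>x. cis (of_int n * x)) has_integral
     cis (of_int n * pi) / (\<i> * of_int n) - cis (of_int n * (-pi)) / (\<i> * of_int n)) {-pi..pi}"
    by (intro fundamental_theorem_of_calculus) auto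
  moreover have "cis (of_int n * pi) = cis (of_int n * (-pi))"
    using sin_integer_2pi[of "of_int n"] sin_zero_iff_int2[of "of_int n * pi"] by (simp add: complex_eq_iff)
  ultimately show ?thesis using False by simp
qed

text \<open>Uniform convergence lets the integrals of finite partial sums converge to the integral
  of the sum; by orthogonality they are constant as soon as the index set contains
  \<open>m\<close>.\<close>

lemma integral_fser_cis:
  assumes "wbounded a"
  shows "((\<lambda>x. fser a x * cis (- (of_int m * x))) has_integral of_real (2 * pi * a m)) {-pi..pi}"
proof -
  obtain A where A: "\<And>k. \<bar>a k\<bar> \<le> A * ws 0 k"
    using assms by (auto simp: wbounded_def)
  define G where "G k x = complex_of_real (a k) * cis (of_int (k - m) * x)" for k x
  have eq: "fser a x * cis (- (of_int m * x)) = (\<Sum>\<^sub>\<infinity>k. G k x)" for x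
    unfolding fser_def infsum_cmult_left'[symmetric] G_def
    by (simp add: mult.assoc cis_mult algebra_simps)
  have "(\<lambda>k. A * ws 0 k) summable_on UNIV"
    by (intro summable_on_cmult_right summable_ws0)
  then have "uniform_limit {-pi..pi} (\<lambda>X x. \<Sum>k\<in>X. G k x) (\<lambda>x. \<Sum>\<^sub>\<infinity>k. G k x) (finite_subsets_at_top UNIV)"
    by (rule Weierstrass_m_test_general[rotated]) (simp add: G_def norm_mult A)
  moreover have "continuous_on {-pi..pi} (\<lambda>x. \<Sum>k\<in>X. G k x)" for X
    unfolding G_def by (intro continuous_intros)
  ultimately obtain I J where IJ: "\<And>X. ((\<lambda>x. \<Sum>k\<in>X. G k x) has_integral I X) {-pi..pi}"
    "((\<lambda>x. \<Sum>\<^sub>\<infinity>k. G k x) has_integral J) {-pi..pi}" "(I \<longlongrightarrow> J) (finite_subsets_at_top UNIV)"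
    by (rule uniform_limit_integral) auto
  have I: "I X = of_real (2 * pi * a m)" if X: "finite X" "{m} \<subseteq> X" for X
  proof -
    have "(G k has_integral (if k = m then of_real (2 * pi * a m) else 0)) {-pi..pi}" for k
      using has_integral_mult_right[OF integral_cis_int[of "k - m"], of "of_real (a k)"]
      unfolding G_def by (auto simp: mult_ac split: if_splits)
    then have "((\<lambda>x. \<Sum>k\<in>X. G k x) has_integral (\<Sum>k\<in>X. if k = m then of_real (2 * pi * a m) else 0)) {-pi..pi}"
      using X by (intro has_integral_sum) auto
    from has_integral_unique[OF IJ(1) this] show ?thesis
      using X by simp
  qed
  have "eventually (\<lambda>X. I X = of_real (2 * pi * a m)) (finite_subsets_at_top UNIV)"
    unfolding eventually_finite_subsets_at_top
    by (rule exI[of _ "{m}"]) (use I in auto)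
  then have "(I \<longlongrightarrow> of_real (2 * pi * a m)) (finite_subsets_at_top UNIV)"
    by (rule tendsto_eventually)
  then have "J = of_real (2 * pi * a m)"
    using IJ(3) tendsto_unique[of "finite_subsets_at_top UNIV"] by simp
  then show ?thesis
    using IJ(2) by (simp add: eq)
qed

lemma fourier_coeff_Im_fser:
  assumes "wbounded a" "\<And>k. a (- k) = - a k"
  shows "fourier_coeff (\<lambda>x. Im (fser a x)) m = - \<i> * of_real (a m)"
proof -
  have "of_real (Im (fser a x)) = - \<i> * fser a x" for x
    by (subst (2) fser_odd[OF assms]) simp
  then have "((\<lambda>x. of_real (Im (fser a x)) * cis (- (of_int m * x))) has_integral - \<i> * of_real (2 * pi * a m)) {-pi..pi}"
    using has_integral_mult_right[OF integral_fser_cis[OF assms(1), of m], of "- \<i>"]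
    by (simp add: mult.assoc)
  then show ?thesis
    by (simp add: fourier_coeff_def integral_unique)
qed

lemma Lambda_Im_fser:
  assumes "wbounded a" "\<And>k. a (- k) = - a k"
  shows "Lambda (\<lambda>x. Im (fser a x)) x = Im (fser (\<lambda>k. \<bar>of_int k\<bar> * a k) x)"
proof -
  have "(\<Sum>\<^sub>\<infinity>k::int. complex_of_int \<bar>k\<bar> * fourier_coeff (\<lambda>x. Im (fser a x)) k * cis (of_int k * x))
     = - \<i> * fser (\<lambda>k. \<bar>of_int k\<bar> * a k) x"
    unfolding fser_def[of "\<lambda>k. \<bar>of_int k\<bar> * a k"] infsum_cmult_right'[symmetric]
    by (intro infsum_cong) (simp add: fourier_coeff_Im_fser[OF assms] mult_ac flip: of_int_abs)
  then show ?thesis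
    by (simp add: Lambda_def)
qed

lemma continuous_on_Im_fser:
  assumes "wbounded a"
  shows "continuous_on S (\<lambda>x. Im (fser a x))"
proof -
  obtain A where A: "\<And>k. \<bar>a k\<bar> \<le> A * ws 0 k"
    using assms by (auto simp: wbounded_def)
  have "continuous_on S (fser a)"
    unfolding fser_def
    by (rule continuous_on_infsum_dominated[where M = "\<lambda>k. A * ws 0 k"])
       (auto intro!: continuous_intros summable_on_cmult_right summable_ws0 simp: norm_mult A)
  then show ?thesis
    by (intro continuous_intros)
qed

text \<open>The identity \<open>2 sin (k x) cos x = sin ((k + 1) x) + sin ((k - 1) x)\<close> lowers
  the power of the cosine but moves the frequency, so the induction keeps \<open>k\<close>
  arbitrary.\<close>

lemma integral_sin_cos_power_zero:
  fixes g :: "real \<Rightarrow> real"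
  assumes cont: "continuous_on {-pi..pi} g"
    and zero: "\<And>k::int. integral {-pi..pi} (\<lambda>x. g x * sin (of_int k * x)) = 0"
  shows "integral {-pi..pi} (\<lambda>x. g x * sin (of_int k * x) * cos x ^ m) = 0"
proof (induction m arbitrary: k)
  case 0
  then show ?case using zero by simp
next
  case (Suc m)
  have I: "(\<lambda>x. g x * sin (of_int k * x) * cos x ^ m) integrable_on {-pi..pi}" for k :: int
    by (intro integrable_continuous_real continuous_intros cont)
  have "g x * sin (of_int k * x) * cos x ^ Suc m =
      1 / 2 * (g x * sin (of_int (k + 1) * x) * cos x ^ m + g x * sin (of_int (k - 1) * x) * cos x ^ m)" for x
    by (simp add: sin_add sin_diff algebra_simps)
  then show ?case
    using Suc[of "k + 1"] Suc[of "k - 1"] I[of "k + 1"] I[of "k - 1"]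
    by (simp only: integral_mult_right integral_add) simp
qed

text \<open>For odd \<open>g\<close> the function \<open>g x * sin x\<close> is even, so Weierstrass approximation in the variable
  \<open>cos x\<close> on \<open>[0, pi]\<close> applies to it.\<close>
lemma odd_periodic_sin_coeffs_zero:
  fixes g :: "real \<Rightarrow> real"
  assumes cont: "continuous_on UNIV g" and odd: "\<And>x. g (- x) = - g x" and per: "\<And>x. g (x + 2 * pi) = g x"
    and zero: "\<And>k::int. integral {-pi..pi} (\<lambda>x. g x * sin (of_int k * x)) = 0"
  shows "g x = 0"
proof -
  have cg: "continuous_on S g" for S
    using cont continuous_on_subset by blast
  define h where "h x = g x * sin x" for x
  have ch: "continuous_on S h" for S
    unfolding h_def by (intro continuous_intros cg)
  obtain B where B: "\<And>x. x \<in> {-pi..pi} \<Longrightarrow> \<bar>h x\<bar> \<le> B"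
    using compact_imp_bounded[OF compact_continuous_image[OF ch compact_Icc[of "-pi" pi]]]
    unfolding bounded_iff by (auto simp del: atLeastAtMost_iff)
  have "B \<ge> 0" using B[of 0] by (auto simp: h_def)
  \<comment> \<open>\<open>h\<close> is orthogonal to every polynomial in \<open>cos x\<close>, so
    one factor \<open>h\<close> may be replaced by its distance to an approximating
    polynomial.\<close>
  have small: "integral {-pi..pi} (\<lambda>x. h x * h x) \<le> B * e * (2 * pi)" if "e > 0" for e
  proof -
    have "continuous_on {-1..1} (\<lambda>y. h (arccos y))"
      by (rule continuous_on_compose2[OF ch continuous_on_arccos']) auto
    then obtain p where p: "real_polynomial_function p" "\<And>y. y \<in> {-1..1} \<Longrightarrow> \<bar>h (arccos y) - p y\<bar> < e"
      using Stone_Weierstrass_real_polynomial_function[of "{-1..1}" "\<lambda>y. h (arccos y)" e] \<open>e > 0\<close> by auto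
    then obtain a n where pa: "p = (\<lambda>x. \<Sum>i\<le>n. a i * x ^ i)"
      using real_polynomial_function_iff_sum by blast
    have pos: "\<bar>h x - p (cos x)\<bar> < e" if "x \<in> {0..pi}" for x
      using p(2)[of "cos x"] that by (simp add: arccos_cos)
    \<comment> \<open>Both \<open>h\<close> and \<open>cos\<close> are even, so the estimate on
      \<open>[0, pi]\<close> reflects to negative \<open>x\<close>.\<close>
    have approx: "\<bar>h x - p (cos x)\<bar> < e" if "x \<in> {-pi..pi}" for x
      using pos[of x] pos[of "-x"] that odd[of x] by (cases "x \<ge> 0") (auto simp: h_def)
    have cp: "continuous_on S (\<lambda>x. p (cos x))" for S
      unfolding pa by (intro continuous_intros)
    have "integral {-pi..pi} (\<lambda>x. h x * p (cos x)) = (\<Sum>i\<le>n. a i * integral {-pi..pi} (\<lambda>x. h x * cos x ^ i))"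
      unfolding pa sum_distrib_left
      by (subst integral_sum)
         (auto intro!: integrable_continuous_real continuous_intros ch sum.cong
           simp: mult.left_commute simp flip: integral_mult_right)
    also have "\<dots> = 0"
      using integral_sin_cos_power_zero[OF cg zero, of 1] by (simp add: h_def)
    finally have hp: "integral {-pi..pi} (\<lambda>x. h x * p (cos x)) = 0" .
    have "integral {-pi..pi} (\<lambda>x. h x * h x) = integral {-pi..pi} (\<lambda>x. h x * (h x - p (cos x)))"
      unfolding right_diff_distrib
      by (subst integral_diff) (auto intro!: integrable_continuous_real continuous_intros ch cp simp: hp)
    also have "\<dots> \<le> integral {-pi..pi} (\<lambda>x. B * e)"
    proof (rule integral_le)
      fix x assume x: "x \<in> {-pi..pi}"
      have "h x * (h x - p (cos x)) \<le> \<bar>h x\<bar> * \<bar>h x - p (cos x)\<bar>"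
        by (metis abs_ge_self abs_mult)
      also have "\<dots> \<le> B * e"
        using B[OF x] approx[OF x] \<open>B \<ge> 0\<close> by (intro mult_mono) auto
      finally show "h x * (h x - p (cos x)) \<le> B * e" .
    qed (auto intro!: integrable_continuous_real continuous_intros ch cp)
    also have "\<dots> = B * e * (2 * pi)" by simp
    finally show ?thesis .
  qed
  have "integral {-pi..pi} (\<lambda>x. h x * h x) \<le> 0"
  proof (rule field_le_epsilon)
    fix d :: real assume "d > 0"
    \<comment> \<open>\<open>B + 1\<close> replaces \<open>B\<close> because the bound
      \<open>B\<close> may be zero.\<close>
    then have "d / ((B + 1) * (2 * pi)) > 0"
      using \<open>B \<ge> 0\<close> by (intro divide_pos_pos mult_pos_pos) auto
    note small[OF this]
    also have "B * (d / ((B + 1) * (2 * pi))) * (2 * pi) = B / (B + 1) * d"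
      by simp
    also have "\<dots> \<le> 1 * d"
      using \<open>B \<ge> 0\<close> \<open>d > 0\<close> by (intro mult_right_mono) (auto simp: field_simps)
    finally show "integral {-pi..pi} (\<lambda>x. h x * h x) \<le> 0 + d" by simp
  qed
  moreover have "0 \<le> integral {-pi..pi} (\<lambda>x. h x * h x)"
    by (intro integral_nonneg integrable_continuous_real continuous_intros ch) auto
  ultimately have "\<forall>x\<in>{-pi..pi}. h x * h x = 0"
    by (subst integral_eq_0_iff[symmetric]) (auto intro!: continuous_intros ch)
  then have gs: "g x = 0 \<or> sin x = 0" if "x \<in> {-pi..pi}" for x
    using that by (auto simp: h_def)
  \<comment> \<open>At the zeros of the sine, \<open>h = 0\<close> says nothing about
    \<open>g\<close>; there oddness and periodicity decide.\<close>
  have g0: "g 0 = 0" using odd[of 0] by simp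
  have gpi: "g pi = 0" using per[of "-pi"] odd[of pi] by simp
  have gint: "g x = 0" if "x \<in> {-pi..pi}" for x
  proof (cases "sin x = 0")
    case True
    consider "x = 0" | "x = pi" | "x = - pi" | "0 < x" "x < pi" | "0 < - x" "- x < pi"
      using \<open>x \<in> {-pi..pi}\<close> by fastforce
    then show ?thesis
    proof cases
      case 4 then show ?thesis using sin_gt_zero True by fastforce
    next
      case 5 then show ?thesis using sin_gt_zero[of "-x"] True by simp
    qed (use g0 gpi odd[of pi] in auto)
  next
    case False
    then show ?thesis using gs[OF that] by simp
  qed
  have pern: "g (x + 2 * pi * of_int n) = g x" for x n
  proof (induction n rule: int_induct[where k = 0])
    case (step1 i)
    then show ?case using per[of "x + 2 * pi * of_int i"] by (simp add: algebra_simps)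
  next
    case (step2 i)
    then show ?case using per[of "x + 2 * pi * of_int (i - 1)"] by (simp add: algebra_simps)
  qed simp
  define n where "n = \<lfloor>(x + pi) / (2 * pi)\<rfloor>"
  have "of_int n \<le> (x + pi) / (2 * pi)" "(x + pi) / (2 * pi) \<le> of_int n + 1"
    unfolding n_def by linarith+
  then have "x + 2 * pi * of_int (- n) \<in> {-pi..pi}"
    by (simp add: field_simps)
  then show ?thesis
    using gint pern[of x "- n"] by metis
qed

section \<open>The nonlinearity and the Duhamel integral\<close>

text \<open>Right-hand side of the linear equation \<open>q = \<sigma> a^2 + \<tau> a^2 q\<close>,
  read on the Fourier side; its solution is the quotient
  \<open>\<sigma> a^2 / (1 - \<tau> a^2)\<close>.\<close>

definition rat :: "real \<Rightarrow> real \<Rightarrow> (int \<Rightarrow> real) \<Rightarrow> (int \<Rightarrow> real) \<Rightarrow> int \<Rightarrow> real" where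
  "rat \<sigma> \<tau> a q k = \<sigma> * conv a a k + \<tau> * conv (conv a a) q k"

text \<open>With \<open>K = wconst * e\<close> the quadratic term costs \<open>16 K\<close> and the
  cubic one \<open>16 K^2\<close>, in units of the target bound; the surplus \<open>m^2\<close> of
  the cubic term is discarded. The factor 4 in the bound on \<open>a\<close> is the one produced by
  \<open>la_bound\<close>.\<close>

lemma rat_bound:
  assumes c: "0 \<le> c" "0 \<le> m" "m \<le> 1" "0 \<le> e" and small: "wconst * e \<le> 1 / 128"
    and st: "\<bar>\<sigma>\<bar> \<le> 1" "\<bar>\<tau>\<bar> \<le> 1"
    and a: "\<And>j. \<bar>a j\<bar> \<le> 4 * e * m * ws c j" and q: "\<And>j. \<bar>q j\<bar> \<le> e * m^2 * ws c j"
  shows "\<bar>rat \<sigma> \<tau> a q k\<bar> \<le> e * m^2 * ws c k"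
proof -
  define K where "K = wconst * e"
  have K: "0 \<le> K" "K \<le> 1 / 128" using small c wconst_ge_1 by (auto simp: K_def)
  have nn: "0 \<le> 4 * e * m" "0 \<le> e * m^2" "0 \<le> 16 * K * e * m^2"
    using c K by auto
  have aa: "\<bar>conv a a j\<bar> \<le> 16 * K * e * m^2 * ws c j" for j
    using conv_bound[OF c(1) nn(1) nn(1) a a, of j]
    by (simp add: K_def power2_eq_square mult_ac)
  have aaq: "\<bar>conv (conv a a) q k\<bar> \<le> 16 * K^2 * e * m^4 * ws c k"
    using conv_bound[OF c(1) nn(3) nn(2) aa q, of k]
    by (simp add: K_def power2_eq_square power4_eq_xxxx mult_ac)
  have X: "0 \<le> e * m^2 * ws c k" using c by auto
  have "m^4 \<le> m^2" using c by (intro power_decreasing) auto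
  then have "16 * K^2 * e * m^4 * ws c k \<le> 16 * K^2 * e * m^2 * ws c k"
    using c by (intro mult_right_mono mult_left_mono) auto
  also have "\<dots> = (16 * K^2) * (e * m^2 * ws c k)" by simp
  finally have aaq': "\<bar>conv (conv a a) q k\<bar> \<le> (16 * K^2) * (e * m^2 * ws c k)"
    using aaq by linarith
  have "\<bar>rat \<sigma> \<tau> a q k\<bar> \<le> \<bar>\<sigma>\<bar> * \<bar>conv a a k\<bar> + \<bar>\<tau>\<bar> * \<bar>conv (conv a a) q k\<bar>"
    unfolding rat_def by (metis abs_mult abs_triangle_ineq)
  also have "\<dots> \<le> \<bar>conv a a k\<bar> + \<bar>conv (conv a a) q k\<bar>"
    using st by (intro add_mono mult_left_le_one_le) auto
  also have "\<dots> \<le> (16 * K + 16 * K^2) * (e * m^2 * ws c k)"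
    using aa[of k] aaq' by (simp add: algebra_simps)
  also have "\<dots> \<le> 1 * (e * m^2 * ws c k)"
  proof (rule mult_right_mono[OF _ X])
    have "K^2 \<le> K * (1 / 128)" unfolding power2_eq_square using K by (intro mult_left_mono) auto
    then show "16 * K + 16 * K^2 \<le> 1" using K by linarith
  qed
  finally show ?thesis by simp
qed

text \<open>Differencing doubles the quadratic cost to \<open>32 K\<close>; the cubic one becomes
  \<open>32 K^2 + 16 K^2\<close>, one part from each factor that varies.\<close>

lemma rat_diff_bound:
  assumes c: "0 \<le> c" "0 \<le> m" "m \<le> 1" "0 \<le> e" "0 \<le> d" and small: "wconst * e \<le> 1 / 128"
    and st: "\<bar>\<sigma>\<bar> \<le> 1" "\<bar>\<tau>\<bar> \<le> 1"
    and a: "\<And>j. \<bar>a j\<bar> \<le> 4 * e * m * ws c j" "\<And>j. \<bar>a' j\<bar> \<le> 4 * e * m * ws c j"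
      "\<And>j. \<bar>a j - a' j\<bar> \<le> 4 * d * m * ws c j"
    and q: "\<And>j. \<bar>q j\<bar> \<le> e * m^2 * ws c j" "\<And>j. \<bar>q' j\<bar> \<le> e * m^2 * ws c j"
      "\<And>j. \<bar>q j - q' j\<bar> \<le> d * m^2 * ws c j"
  shows "\<bar>rat \<sigma> \<tau> a q k - rat \<sigma> \<tau> a' q' k\<bar> \<le> 1 / 2 * (d * m^2 * ws c k)"
proof -
  define K where "K = wconst * e"
  have K: "0 \<le> K" "K \<le> 1 / 128" using small c wconst_ge_1 by (auto simp: K_def)
  have nn: "0 \<le> 4 * e * m" "0 \<le> e * m^2" "0 \<le> 16 * K * e * m^2" "0 \<le> 4 * d * m" "0 \<le> d * m^2"
      "0 \<le> 32 * K * d * m^2"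
    using c K by auto
  have aa: "\<bar>conv a a j\<bar> \<le> 16 * K * e * m^2 * ws c j" for j
    using conv_bound[OF c(1) nn(1) nn(1) a(1) a(1), of j]
    by (simp add: K_def power2_eq_square mult_ac)
  have aa': "\<bar>conv a' a' j\<bar> \<le> 16 * K * e * m^2 * ws c j" for j
    using conv_bound[OF c(1) nn(1) nn(1) a(2) a(2), of j]
    by (simp add: K_def power2_eq_square mult_ac)
  have daa: "\<bar>conv a a j - conv a' a' j\<bar> \<le> 32 * K * d * m^2 * ws c j" for j
    using conv_diff_bound[OF c(1) nn(1) nn(1) nn(4) nn(4) a a, of j]
    by (simp add: K_def power2_eq_square algebra_simps)
  have daaq: "\<bar>conv (conv a a) q k - conv (conv a' a') q' k\<bar> \<le> 48 * K^2 * d * m^4 * ws c k"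
    using conv_diff_bound[OF c(1) nn(3) nn(2) nn(6) nn(5) aa aa' daa q, of k]
    by (simp add: K_def power2_eq_square power4_eq_xxxx algebra_simps)
  have X: "0 \<le> d * m^2 * ws c k" using c by auto
  have "m^4 \<le> m^2" using c by (intro power_decreasing) auto
  then have "48 * K^2 * d * m^4 * ws c k \<le> 48 * K^2 * d * m^2 * ws c k"
    using c by (intro mult_right_mono mult_left_mono) auto
  also have "\<dots> = (48 * K^2) * (d * m^2 * ws c k)" by simp
  finally have daaq': "\<bar>conv (conv a a) q k - conv (conv a' a') q' k\<bar> \<le> (48 * K^2) * (d * m^2 * ws c k)"
    using daaq by linarith
  have "rat \<sigma> \<tau> a q k - rat \<sigma> \<tau> a' q' k =
      \<sigma> * (conv a a k - conv a' a' k) + \<tau> * (conv (conv a a) q k - conv (conv a' a') q' k)"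
    by (simp add: rat_def algebra_simps)
  then have "\<bar>rat \<sigma> \<tau> a q k - rat \<sigma> \<tau> a' q' k\<bar> \<le>
      \<bar>\<sigma>\<bar> * \<bar>conv a a k - conv a' a' k\<bar> + \<bar>\<tau>\<bar> * \<bar>conv (conv a a) q k - conv (conv a' a') q' k\<bar>"
    by (metis abs_mult abs_triangle_ineq)
  also have "\<dots> \<le> \<bar>conv a a k - conv a' a' k\<bar> + \<bar>conv (conv a a) q k - conv (conv a' a') q' k\<bar>"
    using st by (intro add_mono mult_left_le_one_le) auto
  also have "\<dots> \<le> (32 * K + 48 * K^2) * (d * m^2 * ws c k)"
    using daa[of k] daaq' by (simp add: algebra_simps)
  also have "\<dots> \<le> 1 / 2 * (d * m^2 * ws c k)"
  proof (rule mult_right_mono[OF _ X])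
    have "K^2 \<le> K * (1 / 128)" unfolding power2_eq_square using K by (intro mult_left_mono) auto
    then show "32 * K + 48 * K^2 \<le> 1 / 2" using K by linarith
  qed
  finally show ?thesis .
qed

text \<open>The gain of one power of \<open>n\<close> holds uniformly in \<open>n \<ge> 1\<close>, including the slowest mode \<open>n = 1\<close>,
  because the integrand is at most \<open>4 / (C n)\<close> times the derivative of
  \<open>exp (C s (n - 1) / 2) (1 - exp (- C s) / 2)\<close>.\<close>
lemma duhamel_bound:
  fixes N :: "real \<Rightarrow> real"
  assumes C: "0 < C" and n: "1 \<le> n" and t: "0 \<le> t" and B: "0 \<le> B"
    and cont: "continuous_on {0..t} N"
    and N: "\<And>s. s \<in> {0..t} \<Longrightarrow> \<bar>N s\<bar> \<le> B * exp (- (C * s / 2)) ^ 3 * exp (- (C * s / 2 * n))"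
  shows "exp (C * t / 2) * exp (C * t / 2 * n) * exp (- (C * t * n)) *
      \<bar>integral {0..t} (\<lambda>s. exp (C * s * n) * N s)\<bar> \<le> 4 * B / (C * n)"
proof -
  \<comment> \<open>At \<open>n = 1\<close> the first factor is constant; the second, which stays
    between 1/2 and 1, then carries the whole derivative.\<close>
  define F where "F s = exp (C * s * (n - 1) / 2) * (1 - exp (- (C * s)) / 2)" for s
  define F' where "F' s = C * exp (C * s * (n - 1) / 2) * ((n - 1) / 2 * (1 - exp (- (C * s)) / 2) + exp (- (C * s)) / 2)" for s
  have F: "(F has_real_derivative F' s) (at s within T)" for s T
    unfolding F_def F'_def by (auto intro!: derivative_eq_intros simp: field_simps)
  have "(F' has_integral F t - F 0) {0..t}"
    using t F by (intro fundamental_theorem_of_calculus) (auto simp: has_real_derivative_iff_has_vector_derivative)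
  then have I: "((\<lambda>s. 4 * B / (C * n) * F' s) has_integral 4 * B / (C * n) * (F t - F 0)) {0..t}"
    by (rule has_integral_mult_right)
  have le: "norm (exp (C * s * n) * N s) \<le> 4 * B / (C * n) * F' s" if s: "s \<in> {0..t}" for s
  proof -
    define E where "E = exp (- (C * s))"
    have E: "0 < E" "E \<le> 1" using s C by (auto simp: E_def)
    have "exp (- (C * s / 2)) ^ 3 = exp (3 * - (C * s / 2))"
      using exp_of_nat_mult[of 3 "- (C * s / 2)"] by simp
    then have eq: "exp (C * s * n) * (exp (- (C * s / 2)) ^ 3 * exp (- (C * s / 2 * n))) =
        exp (C * s * (n - 1) / 2) * E"
      by (simp add: E_def exp_add[symmetric] field_simps)
    \<comment> \<open>As \<open>E \<le> 1\<close>, \<open>1 - E / 2\<close> is at least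
      \<open>E / 2\<close>, so the right side is at least \<open>(n + 1) / 4 * E\<close>.\<close>
    have "n / 4 * E \<le> (n - 1) / 2 * (1 - E / 2) + E / 2"
    proof -
      have "(n - 1) / 2 * (E / 2) \<le> (n - 1) / 2 * (1 - E / 2)"
        using n E by (intro mult_left_mono) auto
      moreover have "n / 4 * E \<le> (n - 1) / 2 * (E / 2) + E / 2"
        using E by (simp add: field_simps)
      ultimately show ?thesis by linarith
    qed
    then have "4 / n * (exp (C * s * (n - 1) / 2) * (n / 4 * E)) \<le>
        4 / n * (exp (C * s * (n - 1) / 2) * ((n - 1) / 2 * (1 - E / 2) + E / 2))"
      using n by (intro mult_left_mono) auto
    also have "\<dots> = 4 / (C * n) * F' s"
      using C by (simp add: F'_def E_def)
    finally have "exp (C * s * (n - 1) / 2) * E \<le> 4 / (C * n) * F' s"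
      using n by simp
    then have F'_ge: "B * (exp (C * s * (n - 1) / 2) * E) \<le> B * (4 / (C * n) * F' s)"
      using B by (rule mult_left_mono)
    have "norm (exp (C * s * n) * N s) \<le> exp (C * s * n) * (B * exp (- (C * s / 2)) ^ 3 * exp (- (C * s / 2 * n)))"
      using N[OF s] by (simp add: abs_mult)
    also have "\<dots> = B * (exp (C * s * (n - 1) / 2) * E)"
      unfolding eq[symmetric] by simp
    also note F'_ge
    finally show ?thesis by (simp add: mult_ac)
  qed
  have "norm (integral {0..t} (\<lambda>s. exp (C * s * n) * N s)) \<le> integral {0..t} (\<lambda>s. 4 * B / (C * n) * F' s)"
    by (intro integral_norm_bound_integral le has_integral_integrable[OF I])
      (auto intro!: integrable_continuous_real continuous_intros cont)
  also have "\<dots> = 4 * B / (C * n) * (F t - F 0)"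
    using I by (rule integral_unique)
  also have "\<dots> \<le> 4 * B / (C * n) * exp (C * t * (n - 1) / 2)"
  proof (rule mult_left_mono)
    have "F t \<le> exp (C * t * (n - 1) / 2) * 1"
      unfolding F_def by (intro mult_left_mono) auto
    moreover have "F 0 = 1 / 2" by (simp add: F_def)
    ultimately show "F t - F 0 \<le> exp (C * t * (n - 1) / 2)" by linarith
  qed (use B C n in auto)
  finally have "exp (C * t / 2) * exp (C * t / 2 * n) * exp (- (C * t * n)) *
      \<bar>integral {0..t} (\<lambda>s. exp (C * s * n) * N s)\<bar> \<le>
     exp (C * t / 2) * exp (C * t / 2 * n) * exp (- (C * t * n)) * (4 * B / (C * n) * exp (C * t * (n - 1) / 2))"
    by (intro mult_left_mono) auto
  also have "\<dots> = 4 * B / (C * n) * (exp (C * t / 2) * exp (C * t / 2 * n) * exp (- (C * t * n)) * exp (C * t * (n - 1) / 2))"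
    by simp
  also have "exp (C * t / 2) * exp (C * t / 2 * n) * exp (- (C * t * n)) * exp (C * t * (n - 1) / 2) = 1"
    by (simp add: exp_add[symmetric] field_simps)
  finally show ?thesis by simp
qed

text \<open>\<open>nat\<close> and \<open>int\<close> carry the discrete topology, so near any point
  the function depends on \<open>t\<close> alone. All modes and components can thus be packed into
  one bounded continuous function.\<close>

lemma continuous_on_discrete_params:
  fixes f :: "nat \<times> real \<times> int \<Rightarrow> real"
  assumes "\<And>i k. continuous_on UNIV (\<lambda>t. f (i, t, k))"
  shows "continuous_on UNIV f"
  unfolding continuous_on_eq_continuous_at[OF open_UNIV]
proof safe
  fix i t k
  have "isCont (\<lambda>t. f (i, t, k)) t"
    using assms by (simp add: continuous_on_eq_continuous_at)
  then have "isCont (\<lambda>z. f (i, fst (snd z), k)) (i, t, k)"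
    by (intro isCont_o2[where g = "\<lambda>t. f (i, t, k)" and f = "\<lambda>z. fst (snd z)"]) (auto intro!: continuous_intros)
  moreover have "\<forall>\<^sub>F z in nhds (i, t, k). f z = f (i, fst (snd z), k)"
  proof -
    have "open ({i} \<times> UNIV \<times> {k} :: (nat \<times> real \<times> int) set)"
      by (intro open_Times open_UNIV open_discrete)
    then have "\<forall>\<^sub>F z in nhds (i, t, k). z \<in> {i} \<times> UNIV \<times> {k}"
      by (rule eventually_nhds_in_open) auto
    then show ?thesis
      by (rule eventually_mono) auto
  qed
  ultimately show "isCont f (i, t, k)"
    using isCont_cong[of f "\<lambda>z. f (i, fst (snd z), k)" "(i, t, k)"] by simp
qed

section \<open>The contraction\<close>

text \<open>The library instance asks for a metric on the domain, which \<open>nat\<close> and \<open>int\<close> do not carry.\<close>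
lemma complete_UNIV_bcontfun:
  "complete (UNIV :: ('a::topological_space \<Rightarrow>\<^sub>C 'b::complete_space) set)"
proof (rule completeI)
  fix f :: "nat \<Rightarrow> 'a \<Rightarrow>\<^sub>C 'b"
  assume "Cauchy f"
  have "uniformly_Cauchy_on UNIV (\<lambda>n. apply_bcontfun (f n))"
  proof (rule uniformly_Cauchy_onI)
    fix d :: real assume "0 < d"
    then obtain M where "\<forall>m\<ge>M. \<forall>n\<ge>M. dist (f m) (f n) < d"
      using \<open>Cauchy f\<close> by (auto simp: Cauchy_def)
    then show "\<exists>M. \<forall>x\<in>UNIV. \<forall>m\<ge>M. \<forall>n\<ge>M. dist (apply_bcontfun (f m) x) (apply_bcontfun (f n) x) < d"
      by (meson dist_fun_lt_imp_dist_val_lt)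
  qed
  then obtain g where "uniform_limit UNIV (\<lambda>n. apply_bcontfun (f n)) g sequentially"
    using Cauchy_uniformly_convergent uniformly_convergent_on_def by metis
  from uniform_limit_bcontfunE[OF this sequentially_bot]
  show "\<exists>l\<in>UNIV. f \<longlonglongrightarrow> l" by (metis UNIV_I)
qed

text \<open>The unknown \<open>u (i, t, k)\<close> collects rescaled Fourier coefficients at frequency \<open>k\<close>: of \<open>f\<close> for
  \<open>i = 0\<close>, of \<open>f_x^2 / (1 + f_x^2)\<close> for \<open>i = 1\<close> and of \<open>f^2 / (L (L - f^2))\<close> for \<open>i \<ge> 2\<close>. Treating the two
  quotients as unknowns determined by linear equations makes the whole system polynomial. The
  coefficients of the odd function \<open>f\<close> are \<open>- \<i> be\<close> with \<open>be\<close> real and odd in \<open>k\<close>;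
  division by zero makes \<open>be\<close> vanish at \<open>k = 0\<close>.\<close>
locale mode_system =
  fixes C L e :: real and b0 :: "int \<Rightarrow> real"
  assumes C_pos: "0 < C" and C_le: "C \<le> 1" and L_ge: "1 \<le> L" and e_pos: "0 < e"
    and small: "wconst * e \<le> C / 128"
    and b0_odd: "\<And>k. b0 (- k) = - b0 k"
    and b0_bound: "\<And>k. \<bar>of_int k\<bar> ^ 3 * \<bar>b0 k\<bar> \<le> e / 2"
begin

text \<open>Half of the decay rate. The exponential in \<open>w t k\<close> supplies at least the
  other half whenever \<open>k\<close> is nonzero.\<close>

definition mu :: "real \<Rightarrow> real" where "mu t = exp (- (C * t / 2))"

abbreviation w :: "real \<Rightarrow> int \<Rightarrow> real" where "w t \<equiv> ws (C * t / 2)"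

definition be :: "(nat \<times> real \<times> int \<Rightarrow> real) \<Rightarrow> real \<Rightarrow> int \<Rightarrow> real" where
  "be u t k = mu t * exp (- (C * t / 2 * \<bar>of_int k\<bar>)) * u (0, t, k) / \<bar>of_int k\<bar> ^ 3"

definition qu :: "nat \<Rightarrow> (nat \<times> real \<times> int \<Rightarrow> real) \<Rightarrow> real \<Rightarrow> int \<Rightarrow> real" where
  "qu i u t k = (mu t)^2 * w t k * u (i, t, k)"

text \<open>Cosine coefficients of \<open>f_x\<close>; like \<open>be\<close> for \<open>f\<close>,
  they are real, but even in \<open>k\<close>.\<close>

definition ga :: "(nat \<times> real \<times> int \<Rightarrow> real) \<Rightarrow> real \<Rightarrow> int \<Rightarrow> real" where
  "ga u t k = of_int k * be u t k"

definition la :: "(nat \<times> real \<times> int \<Rightarrow> real) \<Rightarrow> real \<Rightarrow> int \<Rightarrow> real" where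
  "la u t k = \<bar>of_int k\<bar> * be u t k"

text \<open>Fourier side of \<open>(Q + P) \<Lambda>f\<close>, with \<open>la\<close> standing for
  \<open>\<Lambda>f\<close>.\<close>

definition nl :: "(nat \<times> real \<times> int \<Rightarrow> real) \<Rightarrow> real \<Rightarrow> int \<Rightarrow> real" where
  "nl u t = conv (\<lambda>k. qu 1 u t k + qu 2 u t k) (la u t)"

definition duhamel :: "(nat \<times> real \<times> int \<Rightarrow> real) \<Rightarrow> real \<Rightarrow> int \<Rightarrow> real" where
  "duhamel u t k = exp (- (C * t * \<bar>of_int k\<bar>)) *
     (b0 k + integral {0..t} (\<lambda>s. exp (C * s * \<bar>of_int k\<bar>) * nl u s k))"

text \<open>Each branch undoes the weight contained in \<open>be\<close> or \<open>qu\<close>, so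
  that a fixed point satisfies the unweighted equations. The parameters of the last branch are
  negative because the series of \<open>be\<close> is \<open>\<i> f\<close>, whose square is
  \<open>- f^2\<close>.\<close>

definition rhs :: "(nat \<times> real \<times> int \<Rightarrow> real) \<Rightarrow> nat \<Rightarrow> real \<Rightarrow> int \<Rightarrow> real" where
  "rhs u i t k =
     (if i = 0 then \<bar>of_int k\<bar> ^ 3 * exp (C * t / 2) * exp (C * t / 2 * \<bar>of_int k\<bar>) * duhamel u t k
      else if i = 1 then rat 1 (- 1) (ga u t) (qu 1 u t) k / ((mu t)^2 * w t k)
      else rat (- 1 / L^2) (- 1 / L) (be u t) (qu 2 u t) k / ((mu t)^2 * w t k))"

text \<open>Negative times are frozen at time 0, which keeps the unknown continuous on the whole
  real line.\<close>

definition Phi :: "(nat \<times> real \<times> int \<Rightarrow> real) \<Rightarrow> nat \<times> real \<times> int \<Rightarrow> real" where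
  "Phi u = (\<lambda>(i, t, k). rhs u i (max 0 t) k)"

section \<open>Size of the weighted coefficients\<close>

lemma mu_pos: "0 < mu t"
  by (simp add: mu_def)

lemma mu_le_1: "0 \<le> t \<Longrightarrow> mu t \<le> 1"
  using C_pos by (simp add: mu_def)

lemma small': "wconst * e \<le> 1 / 128"
  using small C_le by simp

text \<open>For \<open>\<bar>k\<bar> \<ge> 1\<close>,
  \<open>1 / k^2 \<le> 4 / (1 + \<bar>k\<bar>)^2\<close>: this is the origin of the factor 4. The
  mode \<open>k = 0\<close> vanishes.\<close>

lemma la_bound:
  assumes "\<bar>u (0, t, k)\<bar> \<le> r"
  shows "\<bar>la u t k\<bar> \<le> 4 * r * mu t * w t k"
proof (cases "k = 0")
  case True
  then show ?thesis
    using assms order_trans[OF abs_ge_zero assms] mu_pos[of t] by (simp add: la_def)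
next
  case False
  define n where "n = \<bar>real_of_int k\<bar>"
  have n: "1 \<le> n" using False by (simp add: n_def)
  have r: "0 \<le> r" using assms by linarith
  define E where "E = exp (- (C * t / 2 * n))"
  have "(1 + n)^2 \<le> (2 * n)^2" using n by (intro power_mono) auto
  then have *: "1 / n^2 \<le> 4 / (1 + n)^2"
    using n by (simp add: field_simps)
  have "\<bar>la u t k\<bar> = mu t * E * \<bar>u (0, t, k)\<bar> * (1 / n^2)"
    using n mu_pos[of t]
    by (simp add: la_def be_def n_def[symmetric] E_def abs_mult power2_eq_square power3_eq_cube)
  also have "\<dots> \<le> mu t * E * r * (4 / (1 + n)^2)"
    using n mu_pos[of t] assms * r by (intro mult_mono) (auto simp: E_def)
  finally show ?thesis
    by (simp add: ws_def E_def n_def mult_ac)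
qed

lemma ga_abs: "\<bar>ga u t k\<bar> = \<bar>la u t k\<bar>"
  by (simp add: ga_def la_def abs_mult)

lemma be_abs_le: "\<bar>be u t k\<bar> \<le> \<bar>la u t k\<bar>"
proof (cases "k = 0")
  case False
  then have "1 * \<bar>be u t k\<bar> \<le> \<bar>real_of_int k\<bar> * \<bar>be u t k\<bar>"
    by (intro mult_right_mono) auto
  then show ?thesis by (simp add: la_def abs_mult)
qed (simp add: be_def)

lemma qu_bound:
  assumes "\<bar>u (i, t, k)\<bar> \<le> r"
  shows "\<bar>qu i u t k\<bar> \<le> r * (mu t)^2 * w t k"
proof -
  have "\<bar>qu i u t k\<bar> = (mu t)^2 * w t k * \<bar>u (i, t, k)\<bar>"
    by (simp add: qu_def abs_mult)
  also have "\<dots> \<le> (mu t)^2 * w t k * r"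
    using assms by (intro mult_left_mono) auto
  finally show ?thesis by (simp add: mult_ac)
qed

text \<open>Linearity in the unknown turns the size bounds into Lipschitz bounds, here and in the
  next three lemmas.\<close>

lemma be_diff: "be u t k - be v t k = be (\<lambda>z. u z - v z) t k"
  by (simp add: be_def diff_divide_distrib right_diff_distrib)

lemma ga_diff: "ga u t k - ga v t k = ga (\<lambda>z. u z - v z) t k"
  by (simp add: ga_def be_diff[symmetric] right_diff_distrib)

lemma la_diff: "la u t k - la v t k = la (\<lambda>z. u z - v z) t k"
  by (simp add: la_def be_diff[symmetric] right_diff_distrib)

lemma qu_diff: "qu i u t k - qu i v t k = qu i (\<lambda>z. u z - v z) t k"
  by (simp add: qu_def right_diff_distrib)

lemma be_bound: "\<bar>u (0, t, k)\<bar> \<le> r \<Longrightarrow> \<bar>be u t k\<bar> \<le> 4 * r * mu t * w t k"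
  using be_abs_le la_bound order_trans by blast

lemma ga_bound: "\<bar>u (0, t, k)\<bar> \<le> r \<Longrightarrow> \<bar>ga u t k\<bar> \<le> 4 * r * mu t * w t k"
  using la_bound by (simp add: ga_abs)

lemma qsum_bound:
  assumes "\<And>i. \<bar>u (i, t, k)\<bar> \<le> r"
  shows "\<bar>qu 1 u t k + qu 2 u t k\<bar> \<le> 2 * r * (mu t)^2 * w t k"
  using qu_bound[of u 1 t k r, OF assms] qu_bound[of u 2 t k r, OF assms] by linarith

text \<open>Two quotients of size \<open>e * mu^2\<close> meet \<open>4 * e * mu\<close>. The
  resulting \<open>mu^3\<close> is the extra decay consumed by \<open>duhamel_bound\<close>.\<close>

lemma nl_bound:
  assumes t: "0 \<le> t" and u: "\<And>z. \<bar>u z\<bar> \<le> e"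
  shows "\<bar>nl u t k\<bar> \<le> 8 * (wconst * e) * e * (mu t)^3 * w t k"
proof -
  have "\<bar>nl u t k\<bar> \<le> wconst * (2 * e * (mu t)^2) * (4 * e * mu t) * w t k"
    unfolding nl_def using e_pos C_pos t mu_pos[of t] less_imp_le[OF mu_pos[of t]]
    by (intro conv_bound qsum_bound la_bound u) auto
  then show ?thesis by (simp add: power2_eq_square power3_eq_cube mult_ac)
qed

lemma nl_diff_bound:
  assumes t: "0 \<le> t" and u: "\<And>z. \<bar>u z\<bar> \<le> e" and v: "\<And>z. \<bar>v z\<bar> \<le> e" and d: "\<And>z. \<bar>u z - v z\<bar> \<le> d"
  shows "\<bar>nl u t k - nl v t k\<bar> \<le> 16 * (wconst * e) * d * (mu t)^3 * w t k"
proof -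
  have "0 \<le> d" using d[of undefined] by linarith
  have "\<bar>nl u t k - nl v t k\<bar> \<le> wconst * ((2 * d * (mu t)^2) * (4 * e * mu t) + (2 * e * (mu t)^2) * (4 * d * mu t)) * w t k"
    unfolding nl_def
  proof (rule conv_diff_bound)
    show "\<bar>qu 1 u t j + qu 2 u t j - (qu 1 v t j + qu 2 v t j)\<bar> \<le> 2 * d * (mu t)^2 * w t j" for j
      using qsum_bound[of "\<lambda>z. u z - v z" t j d, OF d] by (simp add: qu_diff[symmetric] algebra_simps)
    show "\<bar>la u t j - la v t j\<bar> \<le> 4 * d * mu t * w t j" for j
      unfolding la_diff by (intro la_bound d)
  qed (use e_pos C_pos t less_imp_le[OF mu_pos[of t]] \<open>0 \<le> d\<close> in \<open>auto intro!: qsum_bound[unfolded One_nat_def] la_bound u v\<close>)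
  then show ?thesis by (simp add: power2_eq_square power3_eq_cube algebra_simps)
qed

lemma mu_w_le_ws0: "0 \<le> t \<Longrightarrow> (mu t) ^ i * w t k \<le> ws 0 k"
  using mult_mono[of "(mu t) ^ i" 1 "w t k" "ws 0 k"] mu_pos[of t] mu_le_1[of t] C_pos
  by (simp add: power_le_one ws_le_ws0)

section \<open>Continuity and differentiability in time\<close>

lemma continuous_on_section: "continuous_on UNIV u \<Longrightarrow> continuous_on S (\<lambda>t. u (i, t, k))"
  by (rule continuous_on_compose2[of UNIV u]) (auto intro!: continuous_intros)

lemma continuous_on_be: "continuous_on UNIV u \<Longrightarrow> continuous_on S (\<lambda>t. be u t k)"
  unfolding be_def mu_def by (cases "k = 0") (auto intro!: continuous_intros continuous_on_section)

lemma continuous_on_w: "continuous_on S (\<lambda>t. w t k)"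
  unfolding ws_def by (intro continuous_intros) (auto simp: add_pos_nonneg power_eq_0_iff)

lemma continuous_on_mu: "continuous_on S mu"
  unfolding mu_def by (intro continuous_intros) auto

lemma continuous_on_qu: "continuous_on UNIV u \<Longrightarrow> continuous_on S (\<lambda>t. qu i u t k)"
  unfolding qu_def
  by (intro continuous_on_mult continuous_on_power continuous_on_mu continuous_on_w)
     (rule continuous_on_section)

lemma continuous_on_ga: "continuous_on UNIV u \<Longrightarrow> continuous_on S (\<lambda>t. ga u t k)"
  unfolding ga_def by (intro continuous_intros continuous_on_be)

lemma continuous_on_la: "continuous_on UNIV u \<Longrightarrow> continuous_on S (\<lambda>t. la u t k)"
  unfolding la_def by (intro continuous_intros continuous_on_be)

context
  fixes u :: "nat \<times> real \<times> int \<Rightarrow> real"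
  assumes cont: "continuous_on UNIV u" and u: "\<And>z. \<bar>u z\<bar> \<le> e"
begin

lemma la_bound0:
  assumes "0 \<le> t"
  shows "\<bar>la u t k\<bar> \<le> 4 * e * ws 0 k"
proof -
  have "\<bar>la u t k\<bar> \<le> 4 * e * ((mu t)^1 * w t k)"
    using la_bound[of u t k e, OF u] by (simp only: mult.assoc power_one_right)
  also have "\<dots> \<le> 4 * e * ws 0 k"
    using e_pos assms by (intro mult_left_mono mu_w_le_ws0) auto
  finally show ?thesis .
qed

lemma ga_bound0: "0 \<le> t \<Longrightarrow> \<bar>ga u t k\<bar> \<le> 4 * e * ws 0 k"
  using la_bound0 by (simp add: ga_abs)

lemma be_bound0: "0 \<le> t \<Longrightarrow> \<bar>be u t k\<bar> \<le> 4 * e * ws 0 k"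
  using la_bound0 be_abs_le order_trans by blast

lemma qu_bound0:
  assumes "0 \<le> t"
  shows "\<bar>qu i u t k\<bar> \<le> e * ws 0 k"
proof -
  have "\<bar>qu i u t k\<bar> \<le> e * ((mu t)^2 * w t k)"
    using qu_bound[of u i t k e, OF u] by (simp only: mult.assoc)
  also have "\<dots> \<le> e * ws 0 k"
    using e_pos assms by (intro mult_left_mono mu_w_le_ws0) auto
  finally show ?thesis .
qed

lemma nl_bound0:
  assumes "0 \<le> t"
  shows "\<bar>nl u t k\<bar> \<le> 8 * (wconst * e) * e * ws 0 k"
proof -
  have "\<bar>nl u t k\<bar> \<le> 8 * (wconst * e) * e * ((mu t)^3 * w t k)"
    using nl_bound[of t u k, OF assms u] by (simp only: mult.assoc)
  also have "\<dots> \<le> 8 * (wconst * e) * e * ws 0 k"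
    using e_pos wconst_ge_1 assms by (intro mult_left_mono mu_w_le_ws0) auto
  finally show ?thesis .
qed

lemma continuous_on_nl: "continuous_on {0..} (\<lambda>t. nl u t k)"
  unfolding nl_def
proof (rule continuous_on_conv)
  show "\<bar>qu 1 u t k + qu 2 u t k\<bar> \<le> (e + e) * ws 0 k" if "t \<in> {0..}" for t k
    using qu_bound0[of t 1 k] qu_bound0[of t 2 k] that by (simp add: algebra_simps)
  show "\<bar>la u t k\<bar> \<le> (4 * e) * ws 0 k" if "t \<in> {0..}" for t k
    using la_bound0[of t k] that by simp
qed (use e_pos in \<open>auto intro!: continuous_intros continuous_on_qu continuous_on_la cont\<close>)

lemma continuous_on_rat:
  assumes "\<And>k. continuous_on {0..} (\<lambda>t. a t k)" "\<And>t k. 0 \<le> t \<Longrightarrow> \<bar>a t k\<bar> \<le> 4 * e * ws 0 k"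
  shows "continuous_on {0..} (\<lambda>t. rat \<sigma> \<tau> (a t) (qu i u t) k)"
proof -
  have aa: "continuous_on {0..} (\<lambda>t. conv (a t) (a t) k)" for k
    by (rule continuous_on_conv) (use assms e_pos in auto)
  have baa: "\<bar>conv (a t) (a t) k\<bar> \<le> (wconst * (4 * e) * (4 * e)) * ws 0 k" if "0 \<le> t" for t k
    using conv_bound[of 0 "4 * e" "4 * e" "a t" "a t" k] assms(2)[OF that] e_pos by simp
  have "continuous_on {0..} (\<lambda>t. conv (conv (a t) (a t)) (qu i u t) k)"
    by (rule continuous_on_conv[where A = "wconst * (4 * e) * (4 * e)" and B = e])
       (use aa baa qu_bound0 e_pos wconst_ge_1 in \<open>auto intro!: continuous_on_qu cont\<close>)
  then show ?thesis
    unfolding rat_def by (intro continuous_intros aa)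
qed

lemma duhamel_integrable:
  "(\<lambda>s. exp (C * s * \<bar>of_int k\<bar>) * nl u s k) integrable_on {0..t}"
  by (intro integrable_continuous_real continuous_intros continuous_on_subset[OF continuous_on_nl]) auto

lemma duhamel_deriv:
  assumes t: "0 \<le> t"
  shows "((\<lambda>t. duhamel u t k) has_real_derivative - C * \<bar>of_int k\<bar> * duhamel u t k + nl u t k) (at t within {0..})"
proof -
  define g where "g s = exp (C * s * \<bar>of_int k\<bar>) * nl u s k" for s
  have "((\<lambda>s. integral {0..s} g) has_real_derivative g t) (at t within {0..t+1})"
    by (rule integral_has_real_derivative)
       (use t in \<open>auto simp: g_def intro!: continuous_intros continuous_on_subset[OF continuous_on_nl]\<close>)
  \<comment> \<open>The fundamental theorem needs a compact interval; overshooting \<open>t\<close>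
    by 1 makes it locally indistinguishable from the half-line.\<close>
  moreover have "at t within {0..t+1} = at t within {0..}"
    by (rule at_within_nhd[of _ "{..<t+1}"]) auto
  ultimately have I: "((\<lambda>s. integral {0..s} g) has_real_derivative g t) (at t within {0..})"
    by simp
  have "(duhamel u t k = exp (- (C * t * \<bar>of_int k\<bar>)) * (b0 k + integral {0..t} g))" for t
    by (simp add: duhamel_def g_def[abs_def])
  moreover have "exp (- (C * t * \<bar>of_int k\<bar>)) * g t = nl u t k"
    by (simp add: g_def exp_minus)
  ultimately show ?thesis
    by (auto intro!: derivative_eq_intros I simp: algebra_simps)
qed

lemma continuous_on_rhs: "continuous_on {0..} (\<lambda>t. rhs u i t k)"
proof -
  have "continuous_on {0..} (\<lambda>t. duhamel u t k)"
    by (rule DERIV_continuous_on) (rule duhamel_deriv, simp)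
  moreover have "(mu t)^2 * w t k \<noteq> 0" for t
    using mu_pos[of t] ws_pos[of "C * t / 2" k] by (simp del: ws_pos)
  moreover have "continuous_on {0..} (\<lambda>t. (mu t)^2 * w t k)"
    by (intro continuous_on_mult continuous_on_power continuous_on_mu continuous_on_w)
  ultimately show ?thesis
    unfolding rhs_def
    by (cases "i = 0"; cases "i = 1"; simp only: if_True if_False)
       (auto intro!: continuous_intros continuous_on_rat continuous_on_ga continuous_on_be cont ga_bound0 be_bound0)
qed

lemma continuous_on_Phi: "continuous_on UNIV (Phi u)"
proof (rule continuous_on_discrete_params)
  fix i k
  have "continuous_on UNIV (\<lambda>t. rhs u i (max 0 t) k)"
    by (rule continuous_on_compose2[OF continuous_on_rhs]) (auto intro!: continuous_intros)
  then show "continuous_on UNIV (\<lambda>t. Phi u (i, t, k))"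
    by (simp add: Phi_def)
qed

end

text \<open>\<open>duhamel_bound\<close> yields \<open>1 / n\<close> and the weight
  \<open>(1 + n)^-2\<close>; together they absorb the factor \<open>n^3\<close>.\<close>

lemma scaled_duhamel_bound:
  assumes t: "0 \<le> t" and B: "0 \<le> B" and cont: "continuous_on {0..} N"
    and N: "\<And>s. 0 \<le> s \<Longrightarrow> \<bar>N s\<bar> \<le> B * (mu s)^3 * w s k"
  shows "\<bar>of_int k\<bar> ^ 3 * exp (C * t / 2) * exp (C * t / 2 * \<bar>of_int k\<bar>) * exp (- (C * t * \<bar>of_int k\<bar>)) *
    \<bar>integral {0..t} (\<lambda>s. exp (C * s * \<bar>of_int k\<bar>) * N s)\<bar> \<le> 4 * B / C"
proof (cases "k = 0")
  case True
  then show ?thesis using B C_pos by simp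
next
  case False
  define n where "n = \<bar>real_of_int k\<bar>"
  have n: "1 \<le> n" using False by (simp add: n_def)
  have "exp (C * t / 2) * exp (C * t / 2 * n) * exp (- (C * t * n)) *
      \<bar>integral {0..t} (\<lambda>s. exp (C * s * n) * N s)\<bar> \<le> 4 * (B / (1 + n)^2) / (C * n)"
  proof (rule duhamel_bound[OF C_pos n t])
    show "continuous_on {0..t} N" using cont by (rule continuous_on_subset) auto
    show "\<bar>N s\<bar> \<le> B / (1 + n)^2 * exp (- (C * s / 2)) ^ 3 * exp (- (C * s / 2 * n))" if "s \<in> {0..t}" for s
      using N[of s] that by (simp add: mu_def ws_def n_def mult_ac)
  qed (use B in auto)
  from mult_left_mono[OF this, of "n^3"] n
  have "n^3 * exp (C * t / 2) * exp (C * t / 2 * n) * exp (- (C * t * n)) *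
      \<bar>integral {0..t} (\<lambda>s. exp (C * s * n) * N s)\<bar> \<le> n^3 * (4 * (B / (1 + n)^2) / (C * n))"
    by (simp add: mult.assoc)
  also have "\<dots> = 4 * B / C * (n^2 / (1 + n)^2)"
    using n C_pos by (simp add: power2_eq_square power3_eq_cube mult_ac)
  also have "\<dots> \<le> 4 * B / C * 1"
    using n B C_pos by (intro mult_left_mono) (auto simp: power_mono divide_le_eq_1)
  finally show ?thesis by (simp add: n_def)
qed

text \<open>The free flow decays at rate \<open>C n\<close>, while the weight asks for
  \<open>C (n + 1) / 2\<close>; the two agree at \<open>n = 1\<close>.\<close>

lemma exp_cancel: "exp (C * t / 2) * exp (C * t / 2 * n) * exp (- (C * t * n)) \<le> 1" if "0 \<le> t" "1 \<le> n"
proof -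
  have "C * t * 1 \<le> C * t * n" using that C_pos by (intro mult_left_mono) auto
  then show ?thesis by (simp add: exp_add[symmetric] field_simps)
qed

text \<open>For \<open>i = 0\<close> the datum takes at most \<open>e / 2\<close> and the Duhamel
  term at most \<open>32 (wconst e) e / C\<close>, which is no more than
  \<open>e / 4\<close>.\<close>

lemma rhs_bound:
  assumes cont: "continuous_on UNIV u" and u: "\<And>z. \<bar>u z\<bar> \<le> e" and t: "0 \<le> t"
  shows "\<bar>rhs u i t k\<bar> \<le> e"
proof -
  have m: "0 \<le> mu t" "mu t \<le> 1" "0 \<le> C * t / 2" using mu_pos[of t] mu_le_1[OF t] C_pos t by auto
  have pos: "0 < (mu t)^2 * w t k" using mu_pos[of t] by simp
  note [simp] = mu_pos[THEN less_imp_le]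
  show ?thesis
  proof (cases "i = 0")
    case True
    define n where "n = \<bar>real_of_int k\<bar>"
    define I where "I = integral {0..t} (\<lambda>s. exp (C * s * n) * nl u s k)"
    define X where "X = exp (C * t / 2) * exp (C * t / 2 * n) * exp (- (C * t * n))"
    have "rhs u i t k = n^3 * X * (b0 k + I)"
      using True by (simp add: rhs_def duhamel_def n_def I_def X_def)
    then have "\<bar>rhs u i t k\<bar> = n^3 * X * \<bar>b0 k + I\<bar>"
      by (simp add: abs_mult n_def X_def)
    also have "\<dots> \<le> n^3 * X * (\<bar>b0 k\<bar> + \<bar>I\<bar>)"
      by (intro mult_left_mono) (auto simp: n_def X_def)
    also have "\<dots> = X * (n^3 * \<bar>b0 k\<bar>) + n^3 * X * \<bar>I\<bar>"
      by (simp add: algebra_simps)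
    also have "X * (n^3 * \<bar>b0 k\<bar>) \<le> e / 2"
    proof (cases "k = 0")
      case False
      then have "X \<le> 1" unfolding X_def by (intro exp_cancel t) (simp add: n_def)
      then have "X * (n^3 * \<bar>b0 k\<bar>) \<le> n^3 * \<bar>b0 k\<bar>"
        by (intro mult_left_le_one_le) (auto simp: n_def X_def)
      then show ?thesis using b0_bound[of k] by (simp add: n_def)
    qed (use e_pos in \<open>simp add: n_def\<close>)
    also have "n^3 * X * \<bar>I\<bar> \<le> 4 * (8 * (wconst * e) * e) / C"
      using scaled_duhamel_bound[OF t _ continuous_on_nl[OF cont u] nl_bound[OF _ u], of k] e_pos wconst_ge_1
      by (simp add: n_def X_def I_def mult.assoc)
    also have "4 * (8 * (wconst * e) * e) / C \<le> e / 2"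
      using mult_right_mono[OF small, of e] e_pos C_pos by (simp add: field_simps)
    finally show ?thesis by simp
  next
    case False
    have L: "\<bar>- 1 / L^2\<bar> \<le> 1" "\<bar>- 1 / L\<bar> \<le> 1"
      using L_ge by (auto simp: one_le_power)
    have "\<bar>rat 1 (- 1) (ga u t) (qu 1 u t) k\<bar> \<le> e * (mu t)^2 * w t k"
      using e_pos by (intro rat_bound[OF m(3) m(1,2) _ small'] ga_bound qu_bound u) auto
    moreover have "\<bar>rat (- 1 / L^2) (- 1 / L) (be u t) (qu 2 u t) k\<bar> \<le> e * (mu t)^2 * w t k"
      using e_pos by (intro rat_bound[OF m(3) m(1,2) _ small' L] be_bound qu_bound u) auto
    ultimately show ?thesis
      using False pos by (simp add: rhs_def abs_mult pos_divide_le_eq mult.assoc)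
  qed
qed

text \<open>The initial datum cancels. The Duhamel part contributes
  \<open>64 (wconst e) d / C\<close>, and the threshold \<open>C / 128\<close> makes this at most
  \<open>d / 2\<close>.\<close>

lemma rhs_diff_bound:
  assumes cu: "continuous_on UNIV u" and u: "\<And>z. \<bar>u z\<bar> \<le> e"
    and cv: "continuous_on UNIV v" and v: "\<And>z. \<bar>v z\<bar> \<le> e"
    and d: "\<And>z. \<bar>u z - v z\<bar> \<le> d" and t: "0 \<le> t"
  shows "\<bar>rhs u i t k - rhs v i t k\<bar> \<le> 1 / 2 * d"
proof -
  have d0: "0 \<le> d" using d[of undefined] by linarith
  have m: "0 \<le> mu t" "mu t \<le> 1" "0 \<le> C * t / 2" using mu_pos[of t] mu_le_1[OF t] C_pos t by auto
  have pos: "0 < (mu t)^2 * w t k" using mu_pos[of t] by simp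
  show ?thesis
  proof (cases "i = 0")
    case True
    define n where "n = \<bar>real_of_int k\<bar>"
    define X where "X = exp (C * t / 2) * exp (C * t / 2 * n) * exp (- (C * t * n))"
    define D where "D = integral {0..t} (\<lambda>s. exp (C * s * n) * (nl u s k - nl v s k))"
    define I where "I u = integral {0..t} (\<lambda>s. exp (C * s * n) * nl u s k)" for u
    have I: "I u - I v = D"
      unfolding D_def I_def right_diff_distrib n_def
      by (rule integral_diff[symmetric]) (intro duhamel_integrable cu u cv v)+
    have "rhs u i t k = n^3 * X * (b0 k + I u)" for u
      using True by (simp add: rhs_def duhamel_def n_def X_def I_def)
    then have "rhs u i t k - rhs v i t k = n^3 * X * D"
      unfolding I[symmetric] by (simp add: algebra_simps)
    then have "\<bar>rhs u i t k - rhs v i t k\<bar> = n^3 * X * \<bar>D\<bar>"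
      by (simp add: abs_mult n_def X_def)
    also have "n^3 * X * \<bar>D\<bar> \<le> 4 * (16 * (wconst * e) * d) / C"
      using scaled_duhamel_bound[OF t _ continuous_on_diff[OF continuous_on_nl[OF cu u] continuous_on_nl[OF cv v]]
        nl_diff_bound[OF _ u v d], of k] e_pos wconst_ge_1 d0
      by (simp add: n_def X_def D_def mult.assoc)
    also have "4 * (16 * (wconst * e) * d) / C \<le> 1 / 2 * d"
      using mult_right_mono[OF small, of d] d0 C_pos by (simp add: field_simps)
    finally show ?thesis .
  next
    case False
    have L: "\<bar>- 1 / L^2\<bar> \<le> 1" "\<bar>- 1 / L\<bar> \<le> 1"
      using L_ge by (auto simp: one_le_power)
    have q: "\<bar>qu i u t j - qu i v t j\<bar> \<le> d * (mu t)^2 * w t j" for i j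
      unfolding qu_diff by (intro qu_bound d)
    have g: "\<bar>ga u t j - ga v t j\<bar> \<le> 4 * d * mu t * w t j" for j
      unfolding ga_diff by (intro ga_bound d)
    have b: "\<bar>be u t j - be v t j\<bar> \<le> 4 * d * mu t * w t j" for j
      unfolding be_diff by (intro be_bound d)
    have "\<bar>rat 1 (- 1) (ga u t) (qu 1 u t) k - rat 1 (- 1) (ga v t) (qu 1 v t) k\<bar> \<le> 1 / 2 * (d * (mu t)^2 * w t k)"
      using e_pos by (intro rat_diff_bound[OF m(3) m(1,2) _ d0 small'] ga_bound qu_bound u v g q) auto
    moreover have "\<bar>rat (- 1 / L^2) (- 1 / L) (be u t) (qu 2 u t) k - rat (- 1 / L^2) (- 1 / L) (be v t) (qu 2 v t) k\<bar>
        \<le> 1 / 2 * (d * (mu t)^2 * w t k)"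
      using e_pos by (intro rat_diff_bound[OF m(3) m(1,2) _ d0 small' L] be_bound qu_bound u v b q) auto
    ultimately show ?thesis
      using False pos
      by (simp add: rhs_def abs_mult pos_divide_le_eq mult.assoc flip: diff_divide_distrib)
  qed
qed

text \<open>A closed condition preserved by \<open>Phi\<close>, so it can be built into the space of
  the contraction. It keeps the mode \<open>k = 0\<close> of \<open>nl\<close> at zero and makes the
  synthesised series purely real or purely imaginary.\<close>

definition parity :: "(nat \<times> real \<times> int \<Rightarrow> real) \<Rightarrow> bool" where
  "parity u \<longleftrightarrow> (\<forall>i t k. u (i, t, - k) = (if i = 0 then - 1 else 1) * u (i, t, k))"

lemma be_odd: "parity u \<Longrightarrow> be u t (- k) = - be u t k"
  by (simp add: be_def parity_def)

lemma la_odd: "parity u \<Longrightarrow> la u t (- k) = - la u t k"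
  by (simp add: la_def be_odd)

lemma ga_even: "parity u \<Longrightarrow> ga u t (- k) = ga u t k"
  by (simp add: ga_def be_odd)

lemma qu_even: "parity u \<Longrightarrow> 0 < i \<Longrightarrow> qu i u t (- k) = qu i u t k"
  by (simp add: qu_def parity_def)

lemma nl_odd: "parity u \<Longrightarrow> nl u t (- k) = - nl u t k"
  unfolding nl_def
  by (subst conv_parity[where p = 1 and q = "- 1"]) (auto simp: qu_even la_odd)

lemma rat_even:
  assumes "\<And>k. a (- k) = p * a k" "p * p = 1" "\<And>k. q (- k) = q k"
  shows "rat \<sigma> \<tau> a q (- k) = rat \<sigma> \<tau> a q k"
proof -
  have aa: "conv a a (- k) = conv a a k" for k
    using conv_parity[of a p a p k] assms(1,2) by simp
  then show ?thesis
    using conv_parity[of "conv a a" 1 q 1 k] assms(3) by (simp add: rat_def)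
qed

lemma parity_Phi:
  assumes u: "parity u"
  shows "parity (Phi u)"
proof -
  have "duhamel u t (- k) = - duhamel u t k" for t k
    by (simp add: duhamel_def b0_odd nl_odd[OF u] algebra_simps)
  then show ?thesis
    unfolding parity_def Phi_def rhs_def
    using rat_even[of "ga u _" 1 "qu 1 u _"] rat_even[of "be u _" "- 1" "qu 2 u _"]
    by (simp add: ga_even[OF u] be_odd[OF u] qu_even[OF u])
qed

lemma fixed_point_exists:
  obtains u where "continuous_on UNIV u" "\<And>z. \<bar>u z\<bar> \<le> e" "parity u"
    "\<And>i t k. 0 \<le> t \<Longrightarrow> u (i, t, k) = rhs u i t k"
proof -
  define S :: "((nat \<times> real \<times> int) \<Rightarrow>\<^sub>C real) set" where
    "S = {u. (\<forall>z. \<bar>apply_bcontfun u z\<bar> \<le> e) \<and> parity (apply_bcontfun u)}"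
  \<comment> \<open>\<open>Bcontfun\<close> is inverted by \<open>apply_bcontfun\<close> only on
    bounded continuous functions, which is established for \<open>u\<close> in
    \<open>S\<close>.\<close>
  define T where "T u = Bcontfun (Phi (apply_bcontfun u))" for u :: "(nat \<times> real \<times> int) \<Rightarrow>\<^sub>C real"
  have T: "apply_bcontfun (T u) = Phi (apply_bcontfun u)" if "u \<in> S" for u
  proof -
    have "Phi (apply_bcontfun u) \<in> bcontfun"
    proof (rule bcontfun_normI)
      show "continuous_on UNIV (Phi (apply_bcontfun u))"
        using that by (intro continuous_on_Phi) (auto simp: S_def)
      show "norm (Phi (apply_bcontfun u) z) \<le> e" for z
        using that by (cases z) (auto simp: S_def Phi_def intro!: rhs_bound)
    qed
    then show ?thesis by (simp add: T_def Bcontfun_inverse)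
  qed
  have "\<exists>!u\<in>S. T u = u"
  proof (rule Banach_fix)
    \<comment> \<open>\<open>S\<close> is cut out by conditions on point values, so continuity of
      evaluation makes it closed.\<close>
    have ev: "continuous_on UNIV (\<lambda>u :: (nat \<times> real \<times> int) \<Rightarrow>\<^sub>C real. apply_bcontfun u z)" for z
    proof (rule lipschitz_on_continuous_on)
      show "1-lipschitz_on UNIV (\<lambda>u :: (nat \<times> real \<times> int) \<Rightarrow>\<^sub>C real. apply_bcontfun u z)"
        by (rule lipschitz_onI) (auto simp: dist_bounded)
    qed
    have "closed S"
      unfolding S_def parity_def
      by (intro closed_Collect_conj closed_Collect_all closed_Collect_le closed_Collect_eq continuous_intros ev)
    then show "complete S" by (rule complete_closed_subset[OF _ subset_UNIV complete_UNIV_bcontfun])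
    have "0 \<in> S" using e_pos by (simp add: S_def parity_def)
    then show "S \<noteq> {}" by auto
    show "T ` S \<subseteq> S"
    proof safe
      fix u assume u: "u \<in> S"
      have "\<bar>Phi (apply_bcontfun u) z\<bar> \<le> e" for z
        using u by (cases z) (auto simp: S_def Phi_def intro!: rhs_bound)
      then show "T u \<in> S"
        using u parity_Phi T[OF u] unfolding S_def by simp
    qed
    show "dist (T u) (T v) \<le> (1 / 2) * dist u v" if uv: "u \<in> S" "v \<in> S" for u v
    proof (rule dist_bound)
      fix z
      have "\<bar>apply_bcontfun u z - apply_bcontfun v z\<bar> \<le> dist u v" for z
        using dist_bounded[of u z v] by (simp add: dist_real_def)
      then show "dist (apply_bcontfun (T u) z) (apply_bcontfun (T v) z) \<le> (1 / 2) * dist u v"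
        using uv unfolding T[OF uv(1)] T[OF uv(2)] Phi_def dist_real_def
        by (cases z) (auto simp: S_def intro!: rhs_diff_bound[simplified])
    qed
  qed auto
  then obtain u where u: "u \<in> S" "T u = u" by auto
  show ?thesis
  proof (rule that[of "apply_bcontfun u"])
    show "apply_bcontfun u (i, t, k) = rhs (apply_bcontfun u) i t k" if "0 \<le> t" for i t k
      using T[OF u(1)] that unfolding u(2) by (simp add: Phi_def fun_eq_iff)
  qed (use u in \<open>auto simp: S_def\<close>)
qed

end

section \<open>Synthesis of the solution\<close>

lemma fser_rat:
  assumes "wbounded a" "wbounded q"
  shows "fser (rat \<sigma> \<tau> a q) x = of_real \<sigma> * (fser a x)^2 + of_real \<tau> * ((fser a x)^2 * fser q x)"
proof -
  note w = wbounded_conv[OF assms(1) assms(1)] wbounded_conv[OF wbounded_conv[OF assms(1) assms(1)] assms(2)]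
  have "fser (rat \<sigma> \<tau> a q) x = fser (\<lambda>k. \<sigma> * conv a a k + \<tau> * conv (conv a a) q k) x"
    by (simp add: rat_def[abs_def])
  also have "\<dots> = of_real \<sigma> * fser (conv a a) x + of_real \<tau> * fser (conv (conv a a) q) x"
    by (subst fser_add) (auto intro!: wbounded_cmult w simp: fser_cmult)
  finally show ?thesis
    by (simp add: fser_conv[OF assms(1) assms(1)] fser_conv[OF w(1) assms(2)] power2_eq_square)
qed

text \<open>Squaring \<open>m (1 + n) \<le> 1 + a n / 2 \<le> exp (a n / 2)\<close> gives the bound.
  It turns exponential decay at positive times into summability.\<close>

lemma exp_le_ws0:
  assumes "0 < a"
  shows "exp (- (a * \<bar>of_int k\<bar>)) \<le> 1 / (min 1 (a / 2))^2 * ws 0 k"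
proof -
  define n m where "n = \<bar>real_of_int k\<bar>" and "m = min 1 (a / 2)"
  have n: "0 \<le> n" and m: "0 < m" "m \<le> 1" "m \<le> a / 2"
    using assms by (auto simp: n_def m_def)
  have "m * (1 + n) \<le> 1 + a / 2 * n"
    using m n mult_right_mono[OF m(3) n] by (simp add: algebra_simps)
  also have "\<dots> \<le> exp (a / 2 * n)"
    by (rule exp_ge_add_one_self)
  finally have "(m * (1 + n))^2 \<le> exp (a / 2 * n)^2"
    using m n by (intro power_mono) auto
  also have "\<dots> = exp (a * n)"
    by (simp add: power2_eq_square exp_add[symmetric])
  finally have "1 / exp (a * n) \<le> 1 / (m * (1 + n))^2"
    using m n by (intro divide_left_mono) auto
  then show ?thesis
    by (simp add: ws_def exp_minus inverse_eq_divide n_def m_def power_mult_distrib)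
qed

lemma integral_sin_fourier_coeff:
  assumes "continuous_on {-pi..pi} f"
  shows "integral {-pi..pi} (\<lambda>x. f x * sin (of_int k * x)) = - 2 * pi * Im (fourier_coeff f k)"
proof -
  define h where "h x = complex_of_real (f x) * cis (- (of_int k * x))" for x
  have h: "h integrable_on {-pi..pi}"
    unfolding h_def by (intro integrable_continuous_real continuous_intros assms)
  have "Im (fourier_coeff f k) = Im (integral {-pi..pi} h) / (2 * pi)"
    unfolding fourier_coeff_def h_def[symmetric] by (rule Im_divide_of_real)
  also have "Im (integral {-pi..pi} h) = integral {-pi..pi} (\<lambda>x. Im (h x))"
    using integral_linear[OF h bounded_linear_Im] by (simp add: o_def)
  also have "\<dots> = - integral {-pi..pi} (\<lambda>x. f x * sin (of_int k * x))"
    by (simp add: h_def)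
  finally show ?thesis by simp
qed

text \<open>The difference is odd, continuous and periodic with vanishing sine coefficients. This
  upgrades equality of coefficients at time 0 to pointwise attainment of the initial datum.\<close>

lemma odd_function_eq_sine_series:
  assumes cont: "continuous_on UNIV f" and odd: "\<And>x. f (- x) = - f x" and per: "\<And>x. f (x + 2 * pi) = f x"
    and b: "\<And>k. b k = - Im (fourier_coeff f k)" "wbounded b" "\<And>k. b (- k) = - b k"
  shows "f x = Im (fser b x)"
proof -
  have cf: "continuous_on S f" for S
    using cont continuous_on_subset by blast
  have oddb: "Im (fser b (- x)) = - Im (fser b x)" for x
    by (simp add: Im_fser[OF b(2)] infsum_uminus)
  have "f x - Im (fser b x) = 0"
  proof (rule odd_periodic_sin_coeffs_zero[where g = "\<lambda>x. f x - Im (fser b x)"])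
    fix k :: int
    have "integral {-pi..pi} (\<lambda>x. (f x - Im (fser b x)) * sin (of_int k * x)) =
        integral {-pi..pi} (\<lambda>x. f x * sin (of_int k * x)) - integral {-pi..pi} (\<lambda>x. Im (fser b x) * sin (of_int k * x))"
      unfolding left_diff_distrib
      by (intro integral_diff integrable_continuous_real continuous_on_mult cf continuous_on_Im_fser b(2))
         (intro continuous_intros)+
    also have "\<dots> = 0"
      by (simp add: integral_sin_fourier_coeff cf continuous_on_Im_fser b(2) fourier_coeff_Im_fser[OF b(2,3)])
         (simp add: b(1))
    finally show "integral {-pi..pi} (\<lambda>x. (f x - Im (fser b x)) * sin (of_int k * x)) = 0" .
  qed (auto simp: odd oddb per fser_periodic intro!: continuous_on_diff cf continuous_on_Im_fser b(2))
  then show ?thesis by simp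
qed

section \<open>The function synthesised from a fixed point\<close>

context mode_system
begin

context
  fixes u :: "nat \<times> real \<times> int \<Rightarrow> real"
  assumes cont: "continuous_on UNIV u" and u: "\<And>z. \<bar>u z\<bar> \<le> e" and par: "parity u"
    and fixp: "\<And>i t k. 0 \<le> t \<Longrightarrow> u (i, t, k) = rhs u i t k"
begin

lemma be_eq_duhamel:
  assumes t: "0 \<le> t"
  shows "be u t k = duhamel u t k"
proof (cases "k = 0")
  case True
  \<comment> \<open>At \<open>k = 0\<close> the weight vanishes and the fixed-point equation is
    empty; oddness makes both sides zero.\<close>
  have "b0 0 = 0" using b0_odd[of 0] by simp
  moreover have "nl u s 0 = 0" for s using nl_odd[OF par, of s 0] by simp
  ultimately show ?thesis using True by (simp add: be_def duhamel_def)
next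
  case False
  define X where "X = exp (C * t / 2) * exp (C * t / 2 * \<bar>of_int k\<bar>)"
  have "mu t * exp (- (C * t / 2 * \<bar>of_int k\<bar>)) * X = 1"
    by (simp add: X_def mu_def exp_minus field_simps)
  moreover have "u (0, t, k) = \<bar>of_int k\<bar> ^ 3 * X * duhamel u t k"
    using fixp[OF t, of 0 k] by (simp add: rhs_def X_def mult.assoc)
  ultimately show ?thesis
    using False by (simp add: be_def field_simps)
qed

lemma be_initial: "be u 0 k = b0 k"
  by (simp add: be_eq_duhamel duhamel_def)

lemma qu1_eq:
  assumes t: "0 \<le> t"
  shows "qu 1 u t = rat 1 (- 1) (ga u t) (qu 1 u t)"
proof
  fix k
  have "(mu t)^2 * w t k \<noteq> 0" using mu_pos[of t] ws_pos[of "C * t / 2" k] by (simp del: ws_pos)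
  then show "qu 1 u t k = rat 1 (- 1) (ga u t) (qu 1 u t) k"
    unfolding qu_def[of 1 u t k] fixp[OF t] by (simp add: rhs_def)
qed

lemma qu2_eq:
  assumes t: "0 \<le> t"
  shows "qu 2 u t = rat (- 1 / L^2) (- 1 / L) (be u t) (qu 2 u t)"
proof
  fix k
  have "(mu t)^2 * w t k \<noteq> 0" using mu_pos[of t] ws_pos[of "C * t / 2" k] by (simp del: ws_pos)
  then show "qu 2 u t k = rat (- 1 / L^2) (- 1 / L) (be u t) (qu 2 u t) k"
    unfolding qu_def[of 2 u t k] fixp[OF t] by (simp add: rhs_def)
qed

lemma wbounded_coeffs:
  assumes t: "0 \<le> t"
  shows "wbounded (be u t)" "wbounded (ga u t)" "wbounded (la u t)" "wbounded (qu i u t)" "wbounded (nl u t)"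
proof -
  show "wbounded (be u t)" "wbounded (ga u t)" "wbounded (la u t)"
    by (rule wboundedI[of "4 * e" 0]; use e_pos be_bound0[OF cont u t] ga_bound0[OF cont u t] la_bound0[OF cont u t] in simp)+
  show "wbounded (qu i u t)"
    by (rule wboundedI[of e 0]; use e_pos qu_bound0[OF cont u t] in simp)
  show "wbounded (nl u t)"
    by (rule wboundedI[of "8 * (wconst * e) * e" 0]; use e_pos wconst_ge_1 nl_bound0[OF cont u t] in simp)
qed

lemma la_decay:
  assumes t: "0 \<le> t"
  shows "\<bar>la u t k\<bar> \<le> 4 * e * exp (- (C * t)) * ws 0 k"
proof (cases "k = 0")
  case True
  then show ?thesis using e_pos by (simp add: la_def)
next
  case False
  define n where "n = \<bar>real_of_int k\<bar>"
  have n: "1 \<le> n" using False by (simp add: n_def)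
  have "C * t * 1 \<le> C * t * n" using n C_pos t by (intro mult_left_mono) auto
  then have "mu t * exp (- (C * t / 2 * n)) \<le> exp (- (C * t))"
    by (simp add: mu_def exp_add[symmetric] field_simps)
  then have "mu t * exp (- (C * t / 2 * n)) / (1 + n)^2 \<le> exp (- (C * t)) / (1 + n)^2"
    by (rule divide_right_mono) simp
  then have "mu t * w t k \<le> exp (- (C * t)) * ws 0 k"
    by (simp add: ws_def n_def)
  then have "4 * e * (mu t * w t k) \<le> 4 * e * (exp (- (C * t)) * ws 0 k)"
    using e_pos by (intro mult_left_mono) auto
  then show ?thesis
    using la_bound[of u t k e, OF u] by (simp add: mult.assoc)
qed

lemma sol_bounds:
  assumes t: "0 \<le> t"
  shows "\<bar>Im (fser (be u t) x)\<bar> \<le> wconst * e * exp (- (C * t))"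
    and "\<bar>Re (fser (ga u t) x)\<bar> \<le> wconst * e * exp (- (C * t))"
proof -
  have "norm (fser a x) \<le> wconst * e * exp (- (C * t))" if "\<And>k. \<bar>a k\<bar> \<le> \<bar>la u t k\<bar>" for a
    using norm_fser_le[of a "4 * e * exp (- (C * t))" x] order_trans[OF that la_decay[OF t]]
    \<comment> \<open>The 4 from \<open>la_bound\<close> times the sum of \<open>ws 0\<close> is
      exactly \<open>wconst\<close>.\<close>
    by (simp add: wconst_def mult_ac)
  from order_trans[OF abs_Im_le_cmod this[OF be_abs_le]] order_trans[OF abs_Re_le_cmod this[OF eq_refl[OF ga_abs]]]
  show "\<bar>Im (fser (be u t) x)\<bar> \<le> wconst * e * exp (- (C * t))"
    and "\<bar>Re (fser (ga u t) x)\<bar> \<le> wconst * e * exp (- (C * t))" by auto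
qed

lemma sol_deriv_x:
  assumes t: "0 \<le> t"
  shows "((\<lambda>x. Im (fser (be u t) x)) has_real_derivative Re (fser (ga u t) x)) (at x)"
proof -
  have ga: "ga u t = (\<lambda>k. of_int k * be u t k)" by (simp add: ga_def[abs_def])
  show ?thesis
    using Im_fser_deriv[OF wbounded_coeffs(1)[OF t] wbounded_coeffs(2)[OF t, unfolded ga]] unfolding ga .
qed

lemma sol_Lambda:
  assumes t: "0 \<le> t"
  shows "Lambda (\<lambda>x. Im (fser (be u t) x)) x = Im (fser (la u t) x)"
  using Lambda_Im_fser[OF wbounded_coeffs(1)[OF t] be_odd[OF par]] by (simp add: la_def[abs_def])

text \<open>The majorant \<open>M\<close> is uniform for all times down to 0, since
  \<open>la\<close> is still of order \<open>\<bar>k\<bar>^-2\<close> there; no analytic smoothing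
  is needed for termwise differentiation.\<close>

lemma sol_deriv_t:
  assumes t: "0 \<le> t"
  shows "((\<lambda>t. Im (fser (be u t) x)) has_real_derivative
     Im (fser (\<lambda>k. - C * la u t k + nl u t k) x)) (at t within {0..})"
proof -
  define M where "M k = C * (4 * e * ws 0 k) + 8 * (wconst * e) * e * ws 0 k" for k
  have "((\<lambda>t. \<Sum>\<^sub>\<infinity>k. be u t k * sin (of_int k * x)) has_field_derivative
      (\<Sum>\<^sub>\<infinity>k. (- C * la u t k + nl u t k) * sin (of_int k * x))) (at t within {0..})"
  proof (rule has_field_derivative_infsum_int)
    show "((\<lambda>t. be u t k * sin (of_int k * x)) has_field_derivative
        (- C * la u s k + nl u s k) * sin (of_int k * x)) (at s within {0..})" if "s \<in> {0..}" for s k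
    proof -
      from that have s: "0 \<le> s" by simp
      have "((\<lambda>t. duhamel u t k) has_real_derivative - C * la u s k + nl u s k) (at s within {0..})"
        using duhamel_deriv[OF cont u s, of k] be_eq_duhamel[OF s, of k] by (simp add: la_def mult.assoc)
      then have "((\<lambda>t. be u t k) has_real_derivative - C * la u s k + nl u s k) (at s within {0..})"
        by (rule has_field_derivative_transform_within[OF _ zero_less_one]) (use s be_eq_duhamel in auto)
      then show ?thesis by (rule DERIV_cmult_right)
    qed
    show "M summable_on UNIV"
      unfolding M_def by (intro summable_on_add summable_on_cmult_right summable_ws0)
    show "norm ((- C * la u s k + nl u s k) * sin (of_int k * x)) \<le> M k" if "s \<in> {0..}" for s k
    proof -
      from that have s: "0 \<le> s" by simp
      have "\<bar>C * la u s k\<bar> \<le> C * (4 * e * ws 0 k)"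
        using la_bound0[OF cont u s, of k] C_pos by (simp add: abs_mult)
      then have 1: "\<bar>- C * la u s k + nl u s k\<bar> \<le> M k"
        using nl_bound0[OF cont u s, of k] unfolding M_def by simp
      have "\<bar>- C * la u s k + nl u s k\<bar> * \<bar>sin (of_int k * x)\<bar> \<le> M k * 1"
        using 1 by (intro mult_mono) auto
      then show ?thesis by (simp add: abs_mult)
    qed
    show "(\<lambda>k. be u s k * sin (of_int k * x)) summable_on UNIV" if "s \<in> {0..}" for s
      using summable_on_Im[OF summable_fser[OF wbounded_coeffs(1), of s x]] that by simp
  qed (use t in auto)
  moreover have "wbounded (\<lambda>k. - C * la u t k + nl u t k)"
    by (intro wbounded_add wbounded_cmult wbounded_coeffs t)
  ultimately have "((\<lambda>t. \<Sum>\<^sub>\<infinity>k. be u t k * sin (of_int k * x)) has_real_derivative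
     Im (fser (\<lambda>k. - C * la u t k + nl u t k) x)) (at t within {0..})"
    by (simp add: Im_fser)
  then show ?thesis
    by (rule has_field_derivative_transform_within[OF _ zero_less_one])
       (use t Im_fser[OF wbounded_coeffs(1)] in auto)
qed

lemma sol_rhs:
  fixes x :: real
  assumes t: "0 \<le> t" and CL: "C = 1 - 1 / L"
  defines "f \<equiv> Im (fser (be u t) x)" and "g \<equiv> Re (fser (ga u t) x)"
  shows "Im (fser (\<lambda>k. - C * la u t k + nl u t k) x) = (- 1 / (1 + g^2) + 1 / (L - f^2)) * Im (fser (la u t) x)"
proof -
  note wb = wbounded_coeffs[OF t]
  define Q P where "Q = fser (qu 1 u t) x" and "P = fser (qu 2 u t) x"
  have quot: "z = of_real (b / a)" if "z * of_real a = of_real b" "a \<noteq> 0" for z :: complex and a b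
    using that by (simp add: nonzero_eq_divide_eq)
  have f: "fser (be u t) x = \<i> * of_real f"
    unfolding f_def by (rule fser_odd[OF wb(1) be_odd[OF par]])
  have g: "fser (ga u t) x = of_real g"
    unfolding g_def by (rule fser_even[OF wb(2) ga_even[OF par]])
  have la: "fser (la u t) x = \<i> * of_real (Im (fser (la u t) x))"
    by (rule fser_odd[OF wb(3) la_odd[OF par]])
  have "Q = of_real (g^2) - of_real (g^2) * Q"
    unfolding Q_def by (subst qu1_eq[OF t]) (simp add: fser_rat[OF wb(2,4)] g)
  then have "Q * of_real (1 + g^2) = of_real (g^2)"
    by (simp add: algebra_simps)
  moreover have g1: "1 + g^2 \<noteq> 0"
    by (metis add_pos_nonneg less_irrefl zero_le_power2 zero_less_one)
  ultimately have Q: "Q = of_real (g^2 / (1 + g^2))"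
    by (rule quot)
  \<comment> \<open>Smallness gives \<open>\<bar>f\<bar> < 1\<close>, and \<open>L \<ge> 1\<close>
    then keeps the denominator \<open>L - f^2\<close> away from zero.\<close>
  have "exp (- (C * t)) \<le> 1" using C_pos t by simp
  then have "wconst * e * exp (- (C * t)) \<le> 1 / 128 * 1"
    using small' by (intro mult_mono) auto
  then have "\<bar>f\<bar> \<le> 1 / 128"
    using sol_bounds(1)[OF t, of x] unfolding f_def by linarith
  then have "f^2 < 1"
    by (simp add: abs_square_less_1)
  then have Lf: "L - f^2 \<noteq> 0" "L \<noteq> 0" using L_ge by auto
  have "P = of_real (f^2 / L^2) + of_real (f^2 / L) * P"
    unfolding P_def by (subst qu2_eq[OF t]) (simp add: fser_rat[OF wb(1,4)] f power_mult_distrib)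
  then have "P * of_real (1 - f^2 / L) = of_real (f^2 / L^2)"
    by (simp add: algebra_simps)
  moreover have "1 - f^2 / L \<noteq> 0" using Lf by (simp add: field_simps)
  ultimately have "P = of_real (f^2 / L^2 / (1 - f^2 / L))"
    by (rule quot)
  also have "f^2 / L^2 / (1 - f^2 / L) = 1 / (L - f^2) - 1 / L"
    using Lf by (simp add: field_simps power2_eq_square)
  finally have P: "P = of_real (1 / (L - f^2) - 1 / L)" .
  have Q': "g^2 / (1 + g^2) = 1 - 1 / (1 + g^2)"
    using g1 by (simp add: field_simps)
  have "fser (nl u t) x = (Q + P) * fser (la u t) x"
    unfolding nl_def Q_def P_def
    by (simp add: fser_conv[OF wbounded_add[OF wb(4) wb(4)] wb(3)] fser_add[OF wb(4) wb(4)])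
  then have "fser (\<lambda>k. - C * la u t k + nl u t k) x = (of_real (- C) + Q + P) * fser (la u t) x"
    by (subst fser_add[OF wbounded_cmult[OF wb(3)] wb(5)]) (simp only: fser_cmult, simp add: algebra_simps)
  \<comment> \<open>Since \<open>C = 1 - 1 / L\<close>, the constants 1 and \<open>1 / L\<close>
    cancel against those of \<open>Q\<close> and \<open>P\<close>.\<close>
  also have "of_real (- C) + Q + P = complex_of_real (- 1 / (1 + g^2) + 1 / (L - f^2))"
    unfolding Q P Q' CL by (simp only: of_real_add[symmetric]) simp
  finally show ?thesis
    by simp
qed

text \<open>For \<open>t > 0\<close> the factor \<open>exp (- C t \<bar>k\<bar>)\<close> makes the
  sum converge. At \<open>t = 0\<close> the bound \<open>\<bar>k\<bar>^-3\<close> alone would leave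
  terms that need not tend to zero.\<close>

lemma sol_in_H3:
  assumes t: "0 < t"
  shows "in_H3 (\<lambda>x. Im (fser (be u t) x))"
  unfolding in_H3_def
proof (intro conjI)
  have t0: "0 \<le> t" using t by simp
  note wb = wbounded_coeffs(1)[OF t0]
  show "periodic2pi (\<lambda>x. Im (fser (be u t) x))"
    by (simp add: periodic2pi_def fser_periodic)
  show "continuous_on UNIV (\<lambda>x. Im (fser (be u t) x))"
    by (rule continuous_on_Im_fser[OF wb])
  have Ct: "0 < C * t" using C_pos t by simp
  show "(\<lambda>k. (1 + (real_of_int k)^2)^3 * (cmod (fourier_coeff (\<lambda>x. Im (fser (be u t) x)) k))^2) summable_on UNIV"
  proof (rule summable_on_dominated)
    show "(\<lambda>k. 8 * e^2 * (1 / (min 1 (C * t / 2))^2 * ws 0 k)) summable_on UNIV"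
      by (intro summable_on_cmult_right summable_ws0)
    fix k :: int
    define n where "n = \<bar>real_of_int k\<bar>"
    have "(1 + n^2)^3 * (be u t k)^2 \<le> 8 * e^2 * exp (- (C * t * n))"
    proof (cases "k = 0")
      case True
      then show ?thesis using e_pos by (simp add: be_def)
    next
      case False
      then have n: "1 \<le> n" by (simp add: n_def)
      have "1 \<le> n^2" using n by (rule one_le_power)
      then have "(1 + n^2)^3 \<le> (2 * n^2)^3" by (intro power_mono) auto
      then have n3: "(1 + n^2)^3 \<le> 8 * n^6" by (simp add: power_mult_distrib)
      have "\<bar>be u t k\<bar> = mu t * exp (- (C * t / 2 * n)) * \<bar>u (0, t, k)\<bar> / n^3"
        using mu_pos[of t] by (simp add: be_def abs_mult n_def)
      also have "\<dots> \<le> 1 * exp (- (C * t / 2 * n)) * e / n^3"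
        using mu_pos[of t] mu_le_1[OF t0] u[of "(0, t, k)"] n
        by (intro divide_right_mono mult_mono) auto
      finally have "\<bar>be u t k\<bar>^2 \<le> (exp (- (C * t / 2 * n)) * e / n^3)^2"
        by (intro power_mono) auto
      also have "\<dots> = exp (- (C * t * n)) * e^2 / n^6"
        by (simp add: power_mult_distrib power_divide power2_eq_square[of "exp _"] exp_add[symmetric])
      finally have "(1 + n^2)^3 * (be u t k)^2 \<le> (8 * n^6) * (exp (- (C * t * n)) * e^2 / n^6)"
        using n3 by (intro mult_mono) auto
      then show ?thesis using n by (simp add: mult_ac)
    qed
    also have "\<dots> \<le> 8 * e^2 * (1 / (min 1 (C * t / 2))^2 * ws 0 k)"
      using exp_le_ws0[OF Ct, of k] unfolding n_def by (intro mult_left_mono) auto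
    finally show "norm ((1 + (real_of_int k)^2)^3 * (cmod (fourier_coeff (\<lambda>x. Im (fser (be u t) x)) k))^2)
        \<le> 8 * e^2 * (1 / (min 1 (C * t / 2))^2 * ws 0 k)"
      by (simp add: fourier_coeff_Im_fser[OF wb be_odd[OF par]] norm_mult n_def)
  qed
qed

lemma sol_C1_norm:
  assumes t: "0 \<le> t"
  shows "C1_norm (\<lambda>x. Im (fser (be u t) x)) \<le> 2 * (wconst * e) * exp (- (C * t))"
proof -
  have "deriv (\<lambda>x. Im (fser (be u t) x)) x = Re (fser (ga u t) x)" for x
    using sol_deriv_x[OF t] by (rule DERIV_imp_deriv)
  then have "C1_norm (\<lambda>x. Im (fser (be u t) x)) =
      (SUP x. \<bar>Im (fser (be u t) x)\<bar>) + (SUP x. \<bar>Re (fser (ga u t) x)\<bar>)"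
    by (simp add: C1_norm_def)
  also have "\<dots> \<le> wconst * e * exp (- (C * t)) + wconst * e * exp (- (C * t))"
    by (intro add_mono cSUP_least sol_bounds t) auto
  finally show ?thesis by simp
qed

end

end

text \<open>A single term of the sum is at most the whole; this passes from the square-summable norm
  of the datum to the weighted sup norm of the contraction.\<close>

lemma cube_fourier_coeff_le_H3_norm:
  assumes "in_H3 f"
  shows "\<bar>of_int k\<bar> ^ 3 * cmod (fourier_coeff f k) \<le> H3_norm f"
proof -
  define g where "g k = (1 + (real_of_int k)^2)^3 * (cmod (fourier_coeff f k))^2" for k :: int
  have "(\<bar>of_int k\<bar> ^ 3 * cmod (fourier_coeff f k))^2 = ((of_int k)^2)^3 * (cmod (fourier_coeff f k))^2"
    by (simp add: power_mult_distrib flip: power_mult)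
  also have "\<dots> \<le> g k"
    unfolding g_def by (intro mult_right_mono power_mono) auto
  also have "\<dots> \<le> (\<Sum>\<^sub>\<infinity>k. g k)"
    using finite_sum_le_infsum[of g UNIV "{k}"] assms by (simp add: in_H3_def g_def[abs_def])
  finally show ?thesis
    unfolding H3_norm_def g_def[symmetric] by (rule real_le_rsqrt)
qed

theorem theorem3:
  fixes l :: real
  assumes "l > 0"
  shows "\<exists>\<delta>>0. \<forall>f0. in_H3 f0 \<and> (\<forall>x. f0 (-x) = - f0 x) \<and> (SUP x. \<bar>f0 x\<bar>) < l \<and>
            (\<forall>x. 1 / (1 + (deriv f0 x)^2) > 1 / (1 + l^2 - (f0 x)^2)) \<and>
            H3_norm f0 \<le> \<delta> \<longrightarrow>
          (\<exists>f :: real \<Rightarrow> real \<Rightarrow> real.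
             f 0 = f0 \<and>
             (\<forall>t\<ge>0. in_H3 (f t)) \<and>
             (\<forall>t\<ge>0. \<forall>x. ((\<lambda>s. f s x) has_real_derivative
                  ((- 1 / (1 + (deriv (f t) x)^2) + 1 / (1 + l^2 - (f t x)^2)) * Lambda (f t) x))
                  (at t within {0..})) \<and>
             (\<forall>t\<ge>0. C1_norm (f t) \<le> l / 4 * exp (- (l^2 / (1 + l^2)) * t)))"
proof -
  define L C where "L = 1 + l^2" and "C = l^2 / (1 + l^2)"
  \<comment> \<open>\<open>C / 128\<close> is the contraction threshold. The \<open>C1_norm\<close>
    adds two suprema, each at most \<open>wconst * e\<close> times the decay factor, so
    \<open>l / 8\<close> yields the required \<open>l / 4\<close>.\<close>
  define e where "e = min (C / 128) (l / 8) / wconst"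
  have L: "1 \<le> L" by (simp add: L_def)
  have l1: "0 < 1 + l^2" by (simp add: add_pos_nonneg)
  have C: "0 < C" "C \<le> 1" "C = 1 - 1 / L"
    using assms l1 by (auto simp: C_def L_def field_simps)
  have e: "0 < e" "wconst * e \<le> C / 128" "wconst * e \<le> l / 8"
  proof -
    have "wconst * e = min (C / 128) (l / 8)"
      using wconst_ge_1 by (simp add: e_def)
    then show "wconst * e \<le> C / 128" "wconst * e \<le> l / 8" by linarith+
    show "0 < e" using C assms wconst_ge_1 by (simp add: e_def)
  qed
  show ?thesis
  proof (intro exI[of _ "e / 2"] conjI allI impI; (elim conjE)?)
    show "0 < e / 2" using e by simp
    fix f0 assume H3: "in_H3 f0" and odd: "\<forall>x. f0 (-x) = - f0 x" and norm: "H3_norm f0 \<le> e / 2"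
    \<comment> \<open>The sign matches the convention that a coefficient equals
      \<open>- \<i>\<close> times the real unknown.\<close>
    define b0 where "b0 k = - Im (fourier_coeff f0 k)" for k
    have cont: "continuous_on S f0" for S
      using H3 continuous_on_subset by (auto simp: in_H3_def)
    have b0: "b0 k = integral {-pi..pi} (\<lambda>x. f0 x * sin (of_int k * x)) / (2 * pi)" for k
      using integral_sin_fourier_coeff[OF cont, of k] by (simp add: b0_def)
    have b0_odd: "b0 (- k) = - b0 k" for k
      by (simp add: b0)
    interpret mode_system C L e b0
    proof
      fix k :: int
      have "\<bar>of_int k\<bar> ^ 3 * \<bar>b0 k\<bar> \<le> \<bar>of_int k\<bar> ^ 3 * cmod (fourier_coeff f0 k)"
        by (intro mult_left_mono) (auto simp: b0_def abs_Im_le_cmod)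
      then show "\<bar>of_int k\<bar> ^ 3 * \<bar>b0 k\<bar> \<le> e / 2"
        using cube_fourier_coeff_le_H3_norm[OF H3, of k] norm by linarith
    qed (use C L e b0_odd in auto)
    obtain u where u: "continuous_on UNIV u" "\<And>z. \<bar>u z\<bar> \<le> e" "parity u"
        "\<And>i t k. 0 \<le> t \<Longrightarrow> u (i, t, k) = rhs u i t k"
      by (rule fixed_point_exists) blast
    define f where "f t x = Im (fser (be u t) x)" for t x
    have be0: "be u 0 = b0"
      using be_initial[OF u] by auto
    have wb0: "wbounded b0"
      using wbounded_coeffs(1)[OF u order.refl] by (simp only: be0)
    have f0: "f 0 = f0"
    proof
      fix x
      have "f0 x = Im (fser b0 x)"
        by (rule odd_function_eq_sine_series[OF cont _ _ b0_def wb0 b0_odd])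
           (use odd H3 in \<open>simp_all add: in_H3_def periodic2pi_def\<close>)
      then show "f 0 x = f0 x" by (simp add: f_def be0)
    qed
    show "\<exists>f. f 0 = f0 \<and> (\<forall>t\<ge>0. in_H3 (f t)) \<and>
             (\<forall>t\<ge>0. \<forall>x. ((\<lambda>s. f s x) has_real_derivative
                  ((- 1 / (1 + (deriv (f t) x)^2) + 1 / (1 + l^2 - (f t x)^2)) * Lambda (f t) x))
                  (at t within {0..})) \<and>
             (\<forall>t\<ge>0. C1_norm (f t) \<le> l / 4 * exp (- (l^2 / (1 + l^2)) * t))"
    proof (intro exI[of _ f] conjI allI impI f0)
      fix t :: real assume t: "0 \<le> t"
      have ft: "f t = (\<lambda>x. Im (fser (be u t) x))" by (simp add: f_def fun_eq_iff)
      show "in_H3 (f t)"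
        \<comment> \<open>At time 0, membership is inherited from the datum; afterwards it comes
          from smoothing.\<close>
        using H3 f0 sol_in_H3[OF u, of t] t by (cases "t = 0") (auto simp: ft[symmetric])
      have "2 * (wconst * e) * exp (- (C * t)) \<le> l / 4 * exp (- (C * t))"
        using e by (intro mult_right_mono) auto
      then have "C1_norm (f t) \<le> l / 4 * exp (- (C * t))"
        unfolding ft using sol_C1_norm[OF u t] by linarith
      then show "C1_norm (f t) \<le> l / 4 * exp (- (l^2 / (1 + l^2)) * t)"
        by (simp only: C_def mult_minus_left)
      show "((\<lambda>s. f s x) has_real_derivative
                  ((- 1 / (1 + (deriv (f t) x)^2) + 1 / (1 + l^2 - (f t x)^2)) * Lambda (f t) x))
                  (at t within {0..})" for x
      proof -
        have d: "deriv (f t) x = Re (fser (ga u t) x)"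
          unfolding ft by (rule DERIV_imp_deriv[OF sol_deriv_x[OF u t]])
        have Lam: "Lambda (f t) x = Im (fser (la u t) x)"
          unfolding ft by (rule sol_Lambda[OF u t])
        have eq: "Im (fser (\<lambda>k. - C * la u t k + nl u t k) x) =
            (- 1 / (1 + (deriv (f t) x)^2) + 1 / (1 + l^2 - (f t x)^2)) * Lambda (f t) x"
          using sol_rhs[OF u t C(3), of x] by (simp only: d Lam f_def L_def)
        show ?thesis
          using sol_deriv_t[OF u t, of x] by (simp only: eq f_def)
      qed
    qed
  qed
qed

end
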